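(* Let $q$ be a prime power, let $V$ be an $n$-dimensional vector space over the finite field $\mathbb{F}_q$, and let $1 \leq k \leq n-1$. Let $\mathcal{D}^k(V)=\tilde{H}_{n-k-1}(X_V;\wedge^k \mathfrak{g})$. Then $$\min \big\{|\mathrm{supp}(w)| : 0 \neq w \in \mathcal{D}^k(V)\big\}=\frac{(n-k+2)!}{2}.$$
   Context: Local systems. Let $X$ be a finite simplicial complex (containing the empty simplex $\emptyset$, of dimension $-1$) with a fixed linear order on its vertices; $X(p)$ is the set of $p$-dimensional simplices. For $\sigma=[s_1,\ldots,s_{p+1}]\in X(p)$ written in increasing order, $\sigma_i$ denotes the face obtained by deleting $s_i$. A local system $\mathcal{F}$ on $X$ assigns an abelian group $\mathcal{F}(\sigma)$ to each simplex $\sigma\in X$ (including $\emptyset$), together with homomorphisms $\rho_\sigma^\tau:\mathcal{F}(\tau)\to\mathcal{F}(\sigma)$ for $\sigma\subset\tau$, with $\rho_\sigma^\sigma=\mathrm{id}$ and $\rho_\eta^\sigma\rho_\sigma^\tau=\rho_\eta^\tau$ for $\eta\subset\sigma\subset\tau$. The group $C_p(X;\mathcal{F})$ consists of formal sums $\sum_{\sigma\in X(p)}c(\sigma)\sigma$ with $c(\sigma)\in\mathcal{F}(\sigma)$ (so $C_{-1}(X;\mathcal{F})=\mathcal{F}(\emptyset)$), and $\partial_p\big(\sum_\sigma c(\sigma)\sigma\big)=\sum_{\sigma\in X(p)}\sum_{i=1}^{p+1}(-1)^{i+1}\rho_{\sigma_i}^\sigma(c(\sigma))\,\sigma_i$ for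 $p\ge 0$. The reduced homology $\tilde{H}_*(X;\mathcal{F})$ is the homology of $\bigoplus_{p\ge -1}C_p(X;\mathcal{F})$. The complex $X_V$. Its vertices are the linear subspaces $0\ne U\subsetneq V$, and its $p$-simplices are the flags $\{U_0\subsetneq\cdots\subsetneq U_p\}$ of such subspaces. The vertices are linearly ordered so that $U$ precedes $U'$ whenever $\dim U<\dim U'$. The local system $\wedge^k\mathfrak{g}$ on $X_V$ is given by $(\wedge^k\mathfrak{g})([U_0\subsetneq\cdots\subsetneq U_p])=\wedge^k U_0$ and $(\wedge^k\mathfrak{g})(\emptyset)=\wedge^k V$, with connecting maps induced by the inclusions of subspaces. Since $\wedge^kU_0=0$ when $\dim U_0<k$, one has $C_{n-k}(X_V;\wedge^k\mathfrak{g})=0$, so $\mathcal{D}^k(V)$ is identified with the space of cycles $\ker\partial_{n-k-1}\subset C_{n-k-1}(X_V;\wedge^k\mathfrak{g})$. The support of a chain $c=\sum_\sigma c(\sigma)\sigma$ is $\mathrm{supp}(c)=\{\sigma: c(\sigma)\neq 0\}$. *)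

theory Defs
  imports
    Complex_Main
    "HOL-Algebra.Product_Groups"
    "HOL-Algebra.FiniteProduct"
    "HOL-Library.Poly_Mapping"
begin

section \<open>Local systems on simplicial complexes and their reduced homology\<close>

text \<open>
  A simplicial complex is a family of finite vertex sets, the empty simplex included.
  Abelian groups are written multiplicatively, following HOL-Algebra.
\<close>

definition simplicial_complex :: "'s set set \<Rightarrow> bool" where
  "simplicial_complex X \<longleftrightarrow>
     {} \<in> X \<and> (\<forall>\<sigma>\<in>X. finite \<sigma>) \<and> (\<forall>\<sigma>\<in>X. \<forall>\<tau>. \<tau> \<subseteq> \<sigma> \<longrightarrow> \<tau> \<in> X)"

definition simplices :: "'s set set \<Rightarrow> int \<Rightarrow> 's set set" where
  "simplices X p = {\<sigma> \<in> X. int (card \<sigma>) = p + 1}"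

text \<open>The connecting map for \<open>\<sigma> \<subseteq> \<tau>\<close> is \<open>\<rho> \<sigma> \<tau> : F \<tau> \<rightarrow> F \<sigma>\<close>.\<close>

locale local_system =
  fixes X :: "'s set set"
    and F :: "'s set \<Rightarrow> 'b monoid"
    and \<rho> :: "'s set \<Rightarrow> 's set \<Rightarrow> 'b \<Rightarrow> 'b"
  assumes complex: "simplicial_complex X"
    and stalk: "\<sigma> \<in> X \<Longrightarrow> comm_group (F \<sigma>)"
    and connecting: "\<lbrakk>\<sigma> \<in> X; \<tau> \<in> X; \<sigma> \<subseteq> \<tau>\<rbrakk> \<Longrightarrow> \<rho> \<sigma> \<tau> \<in> hom (F \<tau>) (F \<sigma>)"
    and connecting_id: "\<lbrakk>\<sigma> \<in> X; x \<in> carrier (F \<sigma>)\<rbrakk> \<Longrightarrow> \<rho> \<sigma> \<sigma> x = x"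
    and connecting_comp:
      "\<lbrakk>\<eta> \<in> X; \<sigma> \<in> X; \<tau> \<in> X; \<eta> \<subseteq> \<sigma>; \<sigma> \<subseteq> \<tau>; x \<in> carrier (F \<tau>)\<rbrakk>
        \<Longrightarrow> \<rho> \<eta> \<sigma> (\<rho> \<sigma> \<tau> x) = \<rho> \<eta> \<tau> x"

text \<open>For a finite complex the formal sums are all of the direct product.\<close>

definition chain_group ::
  "'s set set \<Rightarrow> ('s set \<Rightarrow> 'b monoid) \<Rightarrow> int \<Rightarrow> ('s set \<Rightarrow> 'b) monoid" where
  "chain_group X F p = product_group (simplices X p) F"

text \<open>
  Deleting the vertex \<open>s\<close> from \<open>\<sigma>\<close> carries the sign \<open>(-1)\<^sup>j\<close>, where \<open>j\<close> is the number of vertices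
  of \<open>\<sigma>\<close> strictly preceding \<open>s\<close> in the vertex order \<open>r\<close>; so \<open>s\<close> is the \<open>i\<close>-th vertex with
  \<open>i = j + 1\<close> and the sign is \<open>(-1)\<close> to the \<open>i + 1\<close>.
\<close>

definition boundary ::
  "'s set set \<Rightarrow> 's rel \<Rightarrow> ('s set \<Rightarrow> 'b monoid) \<Rightarrow> ('s set \<Rightarrow> 's set \<Rightarrow> 'b \<Rightarrow> 'b)
    \<Rightarrow> int \<Rightarrow> ('s set \<Rightarrow> 'b) \<Rightarrow> ('s set \<Rightarrow> 'b)" where
  "boundary X r F \<rho> p c =
     (\<lambda>\<tau>\<in>simplices X (p - 1).
        finprod (F \<tau>)
          (\<lambda>(\<sigma>, s). \<rho> \<tau> \<sigma> (c \<sigma>) [^]\<^bsub>F \<tau>\<^esub> ((-1) ^ card {t \<in> \<sigma>. t \<noteq> s \<and> (t, s) \<in> r} :: int))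
          {(\<sigma>, s). \<sigma> \<in> simplices X p \<and> s \<in> \<sigma> \<and> \<sigma> - {s} = \<tau>})"

definition reduced_homology ::
  "'s set set \<Rightarrow> 's rel \<Rightarrow> ('s set \<Rightarrow> 'b monoid) \<Rightarrow> ('s set \<Rightarrow> 's set \<Rightarrow> 'b \<Rightarrow> 'b)
    \<Rightarrow> int \<Rightarrow> ('s set \<Rightarrow> 'b) set monoid" where
  "reduced_homology X r F \<rho> p =
     (chain_group X F p)
       \<lparr>carrier := kernel (chain_group X F p) (chain_group X F (p - 1)) (boundary X r F \<rho> p)\<rparr>
     Mod (boundary X r F \<rho> (p + 1) ` carrier (chain_group X F (p + 1)))"

definition chain_supp ::
  "'s set set \<Rightarrow> ('s set \<Rightarrow> 'b monoid) \<Rightarrow> int \<Rightarrow> ('s set \<Rightarrow> 'b) \<Rightarrow> 's set set" where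
  "chain_supp X F p c = {\<sigma> \<in> simplices X p. c \<sigma> \<noteq> \<one>\<^bsub>F \<sigma>\<^esub>}"


section \<open>Exterior powers\<close>

text \<open>
  The \<open>k\<close>-th exterior power of a subspace \<open>U\<close> is the free vector space on the \<open>k\<close>-tuples of
  elements of \<open>U\<close> (lists of length \<open>k\<close>) modulo the multilinear and alternating relations.
  The scalar \<open>c\<close> in the relations makes the subgroup they generate closed under scalar
  multiplication.
\<close>

definition tuple_space :: "nat \<Rightarrow> 'v set \<Rightarrow> ('v list \<Rightarrow>\<^sub>0 'a::field) monoid" where
  "tuple_space k U =
     \<lparr>carrier = {f. Poly_Mapping.keys f \<subseteq> {xs. length xs = k \<and> set xs \<subseteq> U}},
      mult = (+), one = 0\<rparr>"

definition multilinear_relations ::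
  "('a::field \<Rightarrow> 'v::ab_group_add \<Rightarrow> 'v) \<Rightarrow> nat \<Rightarrow> 'v set \<Rightarrow> ('v list \<Rightarrow>\<^sub>0 'a) set" where
  "multilinear_relations scale k U =
     {Poly_Mapping.single (xs @ [scale a u + scale b v] @ ys) c
        - Poly_Mapping.single (xs @ [u] @ ys) (c * a)
        - Poly_Mapping.single (xs @ [v] @ ys) (c * b) | xs ys u v a b c.
      length xs + 1 + length ys = k \<and> set xs \<subseteq> U \<and> set ys \<subseteq> U \<and> u \<in> U \<and> v \<in> U}"

definition alternating_relations :: "nat \<Rightarrow> 'v set \<Rightarrow> ('v list \<Rightarrow>\<^sub>0 'a::field) set" where
  "alternating_relations k U =
     {Poly_Mapping.single xs c | xs c. length xs = k \<and> set xs \<subseteq> U \<and> \<not> distinct xs}"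

definition exterior_relations ::
  "('a::field \<Rightarrow> 'v::ab_group_add \<Rightarrow> 'v) \<Rightarrow> nat \<Rightarrow> 'v set \<Rightarrow> ('v list \<Rightarrow>\<^sub>0 'a) set" where
  "exterior_relations scale k U =
     generate (tuple_space k U) (multilinear_relations scale k U \<union> alternating_relations k U)"

definition exterior_power ::
  "('a::field \<Rightarrow> 'v::ab_group_add \<Rightarrow> 'v) \<Rightarrow> nat \<Rightarrow> 'v set \<Rightarrow> ('v list \<Rightarrow>\<^sub>0 'a) set monoid" where
  "exterior_power scale k U = tuple_space k U Mod exterior_relations scale k U"

text \<open>
  For an inclusion into \<open>W\<close>, the coset of \<open>f\<close> modulo the relations of the smaller space is
  sent to the coset of \<open>f\<close> modulo the relations of \<open>W\<close>.
\<close>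

definition exterior_incl ::
  "('a::field \<Rightarrow> 'v::ab_group_add \<Rightarrow> 'v) \<Rightarrow> nat \<Rightarrow> 'v set
    \<Rightarrow> ('v list \<Rightarrow>\<^sub>0 'a) set \<Rightarrow> ('v list \<Rightarrow>\<^sub>0 'a) set" where
  "exterior_incl scale k W C = exterior_relations scale k W <#>\<^bsub>tuple_space k W\<^esub> C"


section \<open>The complex of flags and the exterior local system\<close>

text \<open>The ambient vector space is the whole type \<^typ>\<open>'v\<close>.\<close>

definition proper_subspaces :: "('a::field \<Rightarrow> 'v::ab_group_add \<Rightarrow> 'v) \<Rightarrow> 'v set set" where
  "proper_subspaces scale = {U. module.subspace scale U \<and> U \<noteq> {0} \<and> U \<noteq> UNIV}"

definition flag_complex :: "('a::field \<Rightarrow> 'v::ab_group_add \<Rightarrow> 'v) \<Rightarrow> 'v set set set" where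
  "flag_complex scale =
     {\<sigma>. finite \<sigma> \<and> \<sigma> \<subseteq> proper_subspaces scale \<and> (\<forall>U\<in>\<sigma>. \<forall>W\<in>\<sigma>. U \<subseteq> W \<or> W \<subseteq> U)}"

text \<open>
  The smallest member of a nonempty flag \<open>\<sigma>\<close> is \<open>\<Inter>\<sigma>\<close>; for the empty simplex,
  \<open>\<Inter>{} = UNIV\<close> is the ambient space, as required.
\<close>

definition ext_stalk ::
  "('a::field \<Rightarrow> 'v::ab_group_add \<Rightarrow> 'v) \<Rightarrow> nat \<Rightarrow> 'v set set \<Rightarrow> ('v list \<Rightarrow>\<^sub>0 'a) set monoid" where
  "ext_stalk scale k \<sigma> = exterior_power scale k (\<Inter>\<sigma>)"

definition ext_connecting ::
  "('a::field \<Rightarrow> 'v::ab_group_add \<Rightarrow> 'v) \<Rightarrow> nat \<Rightarrow> 'v set set \<Rightarrow> 'v set set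
    \<Rightarrow> ('v list \<Rightarrow>\<^sub>0 'a) set \<Rightarrow> ('v list \<Rightarrow>\<^sub>0 'a) set" where
  "ext_connecting scale k \<sigma> \<tau> = exterior_incl scale k (\<Inter>\<sigma>)"

definition D_group ::
  "('a::field \<Rightarrow> 'v::ab_group_add \<Rightarrow> 'v) \<Rightarrow> 'v set rel \<Rightarrow> nat
    \<Rightarrow> ('v set set \<Rightarrow> ('v list \<Rightarrow>\<^sub>0 'a) set) set monoid" where
  "D_group scale r k =
     reduced_homology (flag_complex scale) r (ext_stalk scale k) (ext_connecting scale k)
       (int (vector_space.dim scale (UNIV :: 'v set)) - int k - 1)"

section \<open>The exterior local system is a local system\<close>

lemma tuple_space_simps [simp]:
  "carrier (tuple_space k U) = {f. Poly_Mapping.keys f \<subseteq> {xs. length xs = k \<and> set xs \<subseteq> U}}"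
  "f \<otimes>\<^bsub>tuple_space k U\<^esub> g = f + g"
  "\<one>\<^bsub>tuple_space k U\<^esub> = 0"
  by (simp_all add: tuple_space_def)

lemma comm_group_tuple_space: "comm_group (tuple_space k U :: ('v list \<Rightarrow>\<^sub>0 'a::field) monoid)"
proof (rule comm_groupI)
  fix x y :: "'v list \<Rightarrow>\<^sub>0 'a"
  assume "x \<in> carrier (tuple_space k U)" "y \<in> carrier (tuple_space k U)"
  then show "x \<otimes>\<^bsub>tuple_space k U\<^esub> y \<in> carrier (tuple_space k U)"
    using Poly_Mapping.keys_add[of x y] by fastforce
next
  fix x :: "'v list \<Rightarrow>\<^sub>0 'a"
  assume "x \<in> carrier (tuple_space k U)"
  then show "\<exists>y\<in>carrier (tuple_space k U). y \<otimes>\<^bsub>tuple_space k U\<^esub> x = \<one>\<^bsub>tuple_space k U\<^esub>"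
    by (intro bexI[of _ "- x"]) (auto simp: keys_minus)
qed (auto simp: add.assoc add.commute)

lemma set_mult_tuple_space: "A <#>\<^bsub>tuple_space k U\<^esub> B = {a + b | a b. a \<in> A \<and> b \<in> B}"
  by (auto simp: set_mult_def)

lemma relations_in_tuple_space:
  assumes "vector_space scale" "module.subspace scale U"
  shows "multilinear_relations scale k U \<union> alternating_relations k U \<subseteq> carrier (tuple_space k U)"
proof -
  interpret vector_space scale by fact
  have *: "Poly_Mapping.keys (f - g - h) \<subseteq> S"
    if "Poly_Mapping.keys f \<subseteq> S" "Poly_Mapping.keys g \<subseteq> S" "Poly_Mapping.keys h \<subseteq> S"
    for f g h :: "'b list \<Rightarrow>\<^sub>0 'a" and S
    using that keys_diff[of "f - g" h] keys_diff[of f g] by blast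
  show ?thesis
  proof (intro subsetI, elim UnE)
    fix f assume "f \<in> multilinear_relations scale k U"
    then obtain xs ys u v a b c where f: "f = Poly_Mapping.single (xs @ [scale a u + scale b v] @ ys) c
        - Poly_Mapping.single (xs @ [u] @ ys) (c * a)
        - Poly_Mapping.single (xs @ [v] @ ys) (c * b)"
      and h: "length xs + 1 + length ys = k" "set xs \<subseteq> U" "set ys \<subseteq> U" "u \<in> U" "v \<in> U"
      unfolding multilinear_relations_def by blast
    have "scale a u + scale b v \<in> U"
      using assms(2) h by (intro subspace_add subspace_scale)
    then show "f \<in> carrier (tuple_space k U)"
      unfolding f tuple_space_simps mem_Collect_eq
      by (intro *) (use h in auto)
  qed (auto simp: alternating_relations_def split: if_splits)
qed

lemma subgroup_exterior_relations:
  assumes "vector_space scale" "module.subspace scale U"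
  shows "subgroup (exterior_relations scale k U) (tuple_space k U)"
  unfolding exterior_relations_def
  using comm_group_tuple_space relations_in_tuple_space[OF assms]
  by (intro group.generate_is_subgroup) (auto simp: comm_group_def)

lemma exterior_relations_mono:
  assumes "vector_space scale" "module.subspace scale W" "U \<subseteq> W" "module.subspace scale U"
  shows "exterior_relations scale k U \<subseteq> exterior_relations scale k W"
proof -
  interpret U: comm_group "tuple_space k U :: ('b list \<Rightarrow>\<^sub>0 'a) monoid" by (rule comm_group_tuple_space)
  interpret W: comm_group "tuple_space k W :: ('b list \<Rightarrow>\<^sub>0 'a) monoid" by (rule comm_group_tuple_space)
  interpret R: subgroup "exterior_relations scale k W" "tuple_space k W"
    by (rule subgroup_exterior_relations[OF assms(1,2)])
  have gen: "multilinear_relations scale k U \<union> alternating_relations k U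
      \<subseteq> multilinear_relations scale k W \<union> alternating_relations k W"
    unfolding multilinear_relations_def alternating_relations_def using assms(3) by fast
  have uminusU: "inv\<^bsub>tuple_space k U\<^esub> f = - f" if "f \<in> carrier (tuple_space k U)"
    for f :: "'b list \<Rightarrow>\<^sub>0 'a"
    using that by (intro U.inv_equality) (auto simp: keys_minus)
  have uminusW: "inv\<^bsub>tuple_space k W\<^esub> f = - f" if "f \<in> carrier (tuple_space k W)"
    for f :: "'b list \<Rightarrow>\<^sub>0 'a"
    using that by (intro W.inv_equality) (auto simp: keys_minus)
  show ?thesis
  proof
    fix f assume "f \<in> exterior_relations scale k U"
    then have "f \<in> generate (tuple_space k U) (multilinear_relations scale k U \<union> alternating_relations k U)"
      by (simp add: exterior_relations_def)
    then show "f \<in> exterior_relations scale k W"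
    proof induction
      case one then show ?case using R.one_closed by simp
    next
      case (incl h) then show ?case using gen
        by (auto simp: exterior_relations_def intro: generate.incl)
    next
      case (inv h)
      have "h \<in> exterior_relations scale k W"
        using inv gen by (auto simp: exterior_relations_def intro: generate.incl)
      moreover have "h \<in> carrier (tuple_space k U)"
        using inv relations_in_tuple_space[OF assms(1,4)] by blast
      ultimately show ?case
        using R.m_inv_closed[of h] uminusU[of h] uminusW[OF subsetD[OF R.subset], of h] by simp
    next
      case (eng h1 h2) then show ?case using R.m_closed[of h1 h2] by simp
    qed
  qed
qed

lemma comm_group_exterior_power:
  assumes "vector_space scale" "module.subspace scale U"
  shows "comm_group (exterior_power scale k U)"
  unfolding exterior_power_def
  by (rule comm_group.abelian_FactGroup[OF comm_group_tuple_space subgroup_exterior_relations[OF assms]])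

lemma exterior_incl_coset:
  assumes "vector_space scale" "module.subspace scale U" "module.subspace scale W" "U \<subseteq> W"
  shows "exterior_incl scale k W (exterior_relations scale k U #>\<^bsub>tuple_space k U\<^esub> f)
         = exterior_relations scale k W #>\<^bsub>tuple_space k W\<^esub> f"
proof -
  interpret R: subgroup "exterior_relations scale k W" "tuple_space k W"
    by (rule subgroup_exterior_relations[OF assms(1,3)])
  interpret Q: subgroup "exterior_relations scale k U" "tuple_space k U"
    by (rule subgroup_exterior_relations[OF assms(1,2)])
  note mono = exterior_relations_mono[OF assms(1,3,4,2), of k]
  have z: "0 \<in> exterior_relations scale k U" using Q.one_closed by simp
  have cl: "x + y \<in> exterior_relations scale k W"
    if "x \<in> exterior_relations scale k W" "y \<in> exterior_relations scale k U" for x y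
    using R.m_closed[of x y] that mono by auto
  show ?thesis
    unfolding exterior_incl_def set_mult_tuple_space r_coset_def tuple_space_simps
  proof (intro subset_antisym subsetI)
    fix x assume "x \<in> {a + b |a b. a \<in> exterior_relations scale k W \<and> b \<in> (\<Union>h\<in>exterior_relations scale k U. {h + f})}"
    then obtain a h where "a \<in> exterior_relations scale k W" "h \<in> exterior_relations scale k U"
      and x: "x = a + (h + f)" by blast
    then have "a + h \<in> exterior_relations scale k W" by (intro cl)
    moreover have "x = (a + h) + f" using x by (simp add: add.assoc)
    ultimately show "x \<in> (\<Union>h\<in>exterior_relations scale k W. {h + f})" by blast
  next
    fix x assume "x \<in> (\<Union>h\<in>exterior_relations scale k W. {h + f})"
    then obtain a where a: "a \<in> exterior_relations scale k W" "x = a + (0 + f)" by auto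
    then show "x \<in> {a + b |a b. a \<in> exterior_relations scale k W \<and> b \<in> (\<Union>h\<in>exterior_relations scale k U. {h + f})}"
      using z by blast
  qed
qed

lemma simplicial_complex_flag_complex: "simplicial_complex (flag_complex scale)"
  unfolding simplicial_complex_def flag_complex_def
  using finite_subset by (auto; blast)

lemma local_system_exterior:
  assumes vs: "vector_space scale"
  shows "local_system (flag_complex scale) (ext_stalk scale k) (ext_connecting scale k)"
proof -
  interpret vector_space scale by fact
  have sub: "subspace (\<Inter>\<sigma>)" if "\<sigma> \<in> flag_complex scale" for \<sigma>
    using that by (intro subspace_Inter) (auto simp: flag_complex_def proper_subspaces_def)
  have elem: "\<exists>f. f \<in> carrier (tuple_space k (\<Inter>\<sigma>)) \<and>
      x = exterior_relations scale k (\<Inter>\<sigma>) #>\<^bsub>tuple_space k (\<Inter>\<sigma>)\<^esub> f"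
    if "x \<in> carrier (ext_stalk scale k \<sigma>)" for x \<sigma>
    using that by (auto simp: ext_stalk_def exterior_power_def carrier_FactGroup)
  show ?thesis
  proof (rule local_system.intro)
    show "simplicial_complex (flag_complex scale)" by (rule simplicial_complex_flag_complex)
  next
    fix \<sigma> assume "\<sigma> \<in> flag_complex scale"
    then show "comm_group (ext_stalk scale k \<sigma>)"
      unfolding ext_stalk_def by (intro comm_group_exterior_power vs sub)
  next
    fix \<sigma> \<tau> :: "'b set set"
    assume st: "\<sigma> \<in> flag_complex scale" "\<tau> \<in> flag_complex scale" "\<sigma> \<subseteq> \<tau>"
    let ?U = "\<Inter>\<tau>" and ?W = "\<Inter>\<sigma>"
    have UW: "?U \<subseteq> ?W" using st by blast
    interpret U: comm_group "tuple_space k ?U :: ('b list \<Rightarrow>\<^sub>0 'a) monoid" by (rule comm_group_tuple_space)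
    interpret W: comm_group "tuple_space k ?W :: ('b list \<Rightarrow>\<^sub>0 'a) monoid" by (rule comm_group_tuple_space)
    interpret NU: normal "exterior_relations scale k ?U" "tuple_space k ?U"
      using U.normal_iff_subgroup subgroup_exterior_relations[OF vs sub[OF st(2)]] by blast
    interpret NW: normal "exterior_relations scale k ?W" "tuple_space k ?W"
      using W.normal_iff_subgroup subgroup_exterior_relations[OF vs sub[OF st(1)]] by blast
    note coset = exterior_incl_coset[OF vs sub[OF st(2)] sub[OF st(1)] UW]
    have car: "f \<in> carrier (tuple_space k ?W)" if "f \<in> carrier (tuple_space k ?U)"
      for f :: "'b list \<Rightarrow>\<^sub>0 'a"
      using that UW by fastforce
    show "ext_connecting scale k \<sigma> \<tau> \<in> hom (ext_stalk scale k \<tau>) (ext_stalk scale k \<sigma>)"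
    proof (rule homI)
      fix x assume "x \<in> carrier (ext_stalk scale k \<tau>)"
      then obtain f where f: "f \<in> carrier (tuple_space k ?U)"
        "x = exterior_relations scale k ?U #>\<^bsub>tuple_space k ?U\<^esub> f" using elem by blast
      then show "ext_connecting scale k \<sigma> \<tau> x \<in> carrier (ext_stalk scale k \<sigma>)"
        using car by (auto simp: ext_connecting_def coset ext_stalk_def exterior_power_def
            carrier_FactGroup simp del: tuple_space_simps(1))
    next
      fix x y assume x: "x \<in> carrier (ext_stalk scale k \<tau>)" and y: "y \<in> carrier (ext_stalk scale k \<tau>)"
      obtain f where f: "f \<in> carrier (tuple_space k ?U)"
        "x = exterior_relations scale k ?U #>\<^bsub>tuple_space k ?U\<^esub> f" using elem[OF x] by blast
      obtain g where g: "g \<in> carrier (tuple_space k ?U)"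
        "y = exterior_relations scale k ?U #>\<^bsub>tuple_space k ?U\<^esub> g" using elem[OF y] by blast
      show "ext_connecting scale k \<sigma> \<tau> (x \<otimes>\<^bsub>ext_stalk scale k \<tau>\<^esub> y) =
        ext_connecting scale k \<sigma> \<tau> x \<otimes>\<^bsub>ext_stalk scale k \<sigma>\<^esub> ext_connecting scale k \<sigma> \<tau> y"
        unfolding ext_connecting_def ext_stalk_def exterior_power_def mult_FactGroup f(2) g(2)
          NU.rcos_sum[OF f(1) g(1)] coset NW.rcos_sum[OF car[OF f(1)] car[OF g(1)]]
        by simp
    qed
  next
    fix \<sigma> x assume s: "\<sigma> \<in> flag_complex scale" and "x \<in> carrier (ext_stalk scale k \<sigma>)"
    then obtain f where "x = exterior_relations scale k (\<Inter>\<sigma>) #>\<^bsub>tuple_space k (\<Inter>\<sigma>)\<^esub> f"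
      using elem by blast
    then show "ext_connecting scale k \<sigma> \<sigma> x = x"
      by (simp add: ext_connecting_def exterior_incl_coset[OF vs sub[OF s] sub[OF s]])
  next
    fix \<eta> \<sigma> \<tau> x
    assume s: "\<eta> \<in> flag_complex scale" "\<sigma> \<in> flag_complex scale" "\<tau> \<in> flag_complex scale"
      and sub': "\<eta> \<subseteq> \<sigma>" "\<sigma> \<subseteq> \<tau>" and "x \<in> carrier (ext_stalk scale k \<tau>)"
    then obtain f where f: "x = exterior_relations scale k (\<Inter>\<tau>) #>\<^bsub>tuple_space k (\<Inter>\<tau>)\<^esub> f"
      using elem by blast
    have i: "\<Inter>\<tau> \<subseteq> \<Inter>\<sigma>" "\<Inter>\<sigma> \<subseteq> \<Inter>\<eta>" "\<Inter>\<tau> \<subseteq> \<Inter>\<eta>" using sub' by blast+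
    show "ext_connecting scale k \<eta> \<sigma> (ext_connecting scale k \<sigma> \<tau> x) = ext_connecting scale k \<eta> \<tau> x"
      unfolding ext_connecting_def f
        exterior_incl_coset[OF vs sub[OF s(3)] sub[OF s(2)] i(1)]
        exterior_incl_coset[OF vs sub[OF s(2)] sub[OF s(1)] i(2)]
        exterior_incl_coset[OF vs sub[OF s(3)] sub[OF s(1)] i(3)] ..
  qed
qed

end

theory Submission
  imports Defs "Jordan_Normal_Form.Determinant"
begin

text \<open>
  Let \<open>m = n - k\<close>. A flag of \<open>m\<close> proper subspaces carries a nonzero coefficient only if its dimensions are
  \<open>k, \<dots>, n - 1\<close>. For the support of a nonzero cycle, the cycle condition says that every member of a flag
  can be exchanged for another one, and that the member of dimension \<open>k\<close> can be exchanged in two ways,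
  because \<open>\<wedge>\<^sup>k H\<close> and \<open>\<wedge>\<^sup>k H'\<close> meet trivially for distinct \<open>k\<close>-dimensional \<open>H\<close>, \<open>H'\<close>. By induction on \<open>m\<close>
  this forces at least \<open>m + 2\<close> top members, each with at least \<open>(m + 1)! / 2\<close> flags below it.

  Equality holds for \<open>m + 2\<close> hyperplanes in general position: modulo a \<open>(k - 1)\<close>-dimensional subspace,
  \<open>V\<close> is the sum-zero hyperplane in \<open>m + 2\<close> coordinates. Its coordinate subspaces are indexed by subsets \<open>B\<close> of the
  coordinates, and the alternating sum over \<open>a \<in> B\<close> of the cycles of \<open>B - {a}\<close>, each coned off by the
  coordinate subspace of \<open>B - {a}\<close>, is again a cycle.
\<close>

section \<open>Relations of exterior powers\<close>

text \<open>An exterior power is given only by cosets of formal sums of tuples, while the exchange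
  argument needs its maps to be injective. So chains are replaced by representatives: a coefficient
  on \<open>\<sigma>\<close> vanishes iff its representative lies in
  \<open>ext_rel k (\<Inter>\<sigma>)\<close>. A retraction onto \<open>H\<close> shows that tuples
  of \<open>H\<close> that are relations of a larger space are already relations of
  \<open>H\<close>; hence a term alone at a face of a cycle would vanish. Determinants of
  functionals serve the opposite purpose: they certify that a given tuple is not a relation.

  The number (m + 2)! / 2 is the product 3 * 4 * ... * (m + 2). The 3 counts the members available
  in dimension \<open>k\<close>: the given one and two replacements. Each further dimension
  multiplies by the number of top members, which exceeds by at least one the corresponding number in
  the link of a fixed top member. The construction has the same factors: a two-element
  \<open>B\<close> carries one generator, and \<open>j + 2\<close> coordinates give
  \<open>j + 2\<close> cones. The sum-zero model supplies its \<open>m + 2\<close> hyperplanes over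
  every field, the field with two elements included.\<close>

definition finsupp_ext :: "('k \<Rightarrow> 'a \<Rightarrow> 'c) \<Rightarrow> ('k \<Rightarrow>\<^sub>0 'a::zero) \<Rightarrow> 'c::comm_monoid_add" where
  "finsupp_ext h f = (\<Sum>x\<in>Poly_Mapping.keys f. h x (Poly_Mapping.lookup f x))"

lemma finsupp_ext_zero [simp]: "finsupp_ext h 0 = 0"
  by (simp add: finsupp_ext_def)

lemma finsupp_ext_single: "h x 0 = 0 \<Longrightarrow> finsupp_ext h (Poly_Mapping.single x c) = h x c"
  by (simp add: finsupp_ext_def)

lemma finsupp_ext_add:
  assumes "\<And>x. h x 0 = 0" "\<And>x a b. h x (a + b) = h x a + h x b"
  shows "finsupp_ext h (f + g) = finsupp_ext h f + finsupp_ext h g"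
  unfolding finsupp_ext_def by (rule setsum_keys_plus_distrib) (simp_all add: assms)

lemma finsupp_ext_uminus:
  fixes h :: "'k \<Rightarrow> 'a::ab_group_add \<Rightarrow> 'c::ab_group_add"
  assumes "\<And>x. h x 0 = 0" "\<And>x a b. h x (a + b) = h x a + h x b"
  shows "finsupp_ext h (- f) = - finsupp_ext h f"
  using finsupp_ext_add[of h f "- f", OF assms] by (simp add: eq_neg_iff_add_eq_0 add.commute)

lemma finsupp_ext_diff:
  fixes h :: "'k \<Rightarrow> 'a::ab_group_add \<Rightarrow> 'c::ab_group_add"
  assumes "\<And>x. h x 0 = 0" "\<And>x a b. h x (a + b) = h x a + h x b"
  shows "finsupp_ext h (f - g) = finsupp_ext h f - finsupp_ext h g"
  using finsupp_ext_add[of h f "- g", OF assms] finsupp_ext_uminus[of h g, OF assms] by simp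

abbreviation tuple_map :: "('v \<Rightarrow> 'w) \<Rightarrow> ('v list \<Rightarrow>\<^sub>0 'a::field) \<Rightarrow> ('w list \<Rightarrow>\<^sub>0 'a)" where
  "tuple_map T \<equiv> finsupp_ext (\<lambda>xs. Poly_Mapping.single (map T xs))"

text \<open>The exterior product of the functionals \<open>\<phi> 0\<close>,
  \<open>\<phi> 1\<close>, ... evaluated on \<open>xs\<close>; it separates tuples from
  relations.\<close>

definition tuple_det :: "(nat \<Rightarrow> 'v \<Rightarrow> 'a::comm_ring_1) \<Rightarrow> 'v list \<Rightarrow> 'a" where
  "tuple_det \<phi> xs = det (mat (length xs) (length xs) (\<lambda>(i, j). \<phi> j (xs ! i)))"

lemma tuple_det_not_distinct:
  assumes "\<not> distinct xs"
  shows "tuple_det \<phi> xs = 0"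
proof -
  obtain i j where "i < length xs" "j < length xs" "i \<noteq> j" "xs ! i = xs ! j"
    using assms by (auto simp: distinct_conv_nth)
  then show ?thesis
    unfolding tuple_det_def by (intro det_identical_rows[of _ "length xs" i j]) auto
qed

text \<open>Leibniz expansion: each summand has exactly one factor that depends on the entry at
  position \<open>length xs\<close>.\<close>

lemma tuple_det_linear:
  assumes "\<And>j. \<phi> j w = a * \<phi> j u + b * \<phi> j v"
  shows "tuple_det \<phi> (xs @ [w] @ ys)
    = a * tuple_det \<phi> (xs @ [u] @ ys) + b * tuple_det \<phi> (xs @ [v] @ ys)"
proof -
  let ?n = "Suc (length xs + length ys)" and ?i = "length xs"
  \<comment> \<open>The \<open>w\<close> here is a placeholder: its position is excluded from the
    product, so \<open>P p\<close> serves for every entry \<open>z\<close>.\<close>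
  define P where "P p = (\<Prod>i\<in>{0..<?n} - {?i}. \<phi> (p i) ((xs @ [w] @ ys) ! i))" for p
  have det: "tuple_det \<phi> (xs @ [z] @ ys)
      = (\<Sum>p\<in>{p. p permutes {0..<?n}}. signof p * (\<phi> (p ?i) z * P p))" for z
  proof -
    have "(\<Prod>i = 0..<?n. mat ?n ?n (\<lambda>(i, j). \<phi> j ((xs @ [z] @ ys) ! i)) $$ (i, p i)) = \<phi> (p ?i) z * P p"
      if p: "p permutes {0..<?n}" for p
    proof -
      have lt: "p i < ?n" if "i < ?n" for i using permutes_in_image[OF p, of i] that by simp
      have "(\<Prod>i = 0..<?n. mat ?n ?n (\<lambda>(i, j). \<phi> j ((xs @ [z] @ ys) ! i)) $$ (i, p i))
        = (\<Prod>i = 0..<?n. \<phi> (p i) ((xs @ [z] @ ys) ! i))"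
        using lt by (intro prod.cong) auto
      also have "\<dots> = \<phi> (p ?i) z * (\<Prod>i\<in>{0..<?n} - {?i}. \<phi> (p i) ((xs @ [z] @ ys) ! i))"
        by (subst prod.remove[of _ ?i]) auto
      also have "(\<Prod>i\<in>{0..<?n} - {?i}. \<phi> (p i) ((xs @ [z] @ ys) ! i)) = P p"
        unfolding P_def by (intro prod.cong) (auto simp: nth_append nth_Cons')
      finally show ?thesis .
    qed
    then show ?thesis
      unfolding tuple_det_def by (subst det_def'[of _ ?n]) (auto intro!: sum.cong)
  qed
  show ?thesis
    unfolding det sum_distrib_left sum.distrib[symmetric]
    by (intro sum.cong) (simp_all add: assms algebra_simps)
qed

section \<open>Relation subgroups, and maps and functionals that respect them\<close>

locale exterior_space = finite_dimensional_vector_space scale Basis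
  for scale :: "'a::field \<Rightarrow> 'b::ab_group_add \<Rightarrow> 'b" and Basis
begin

abbreviation ext_rel :: "nat \<Rightarrow> 'b set \<Rightarrow> ('b list \<Rightarrow>\<^sub>0 'a) set" where
  "ext_rel k U \<equiv> exterior_relations scale k U"

abbreviation tuples :: "nat \<Rightarrow> 'b set \<Rightarrow> ('b list \<Rightarrow>\<^sub>0 'a) set" where
  "tuples k U \<equiv> carrier (tuple_space k U)"

lemma tuple_space_inv:
  assumes "f \<in> tuples k U"
  shows "inv\<^bsub>tuple_space k U\<^esub> f = - f"
proof -
  interpret comm_group "tuple_space k U :: ('b list \<Rightarrow>\<^sub>0 'a) monoid" by (rule comm_group_tuple_space)
  show ?thesis
    using assms by (intro inv_equality) (auto simp: keys_minus)
qed

lemma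
  shows tuples_zero: "0 \<in> tuples k U"
    and tuples_add: "f \<in> tuples k U \<Longrightarrow> g \<in> tuples k U \<Longrightarrow> f + g \<in> tuples k U"
    and tuples_uminus: "f \<in> tuples k U \<Longrightarrow> - f \<in> tuples k U"
    and tuples_single: "length xs = k \<Longrightarrow> set xs \<subseteq> U \<Longrightarrow> Poly_Mapping.single xs c \<in> tuples k U"
  using Poly_Mapping.keys_add[of f g] by (simp_all add: keys_minus) blast

lemma tuples_mono: "U \<subseteq> W \<Longrightarrow> f \<in> tuples k U \<Longrightarrow> f \<in> tuples k W"
  by fastforce

lemma tuples_sum: "(\<And>i. i \<in> I \<Longrightarrow> f i \<in> tuples k U) \<Longrightarrow> sum f I \<in> tuples k U"
  by (induction I rule: infinite_finite_induct) (simp_all add: tuples_zero tuples_add del: tuple_space_simps(1))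

lemma ext_rel_subset: "subspace U \<Longrightarrow> ext_rel k U \<subseteq> tuples k U"
  using subgroup.subset[OF subgroup_exterior_relations] vector_space_axioms by blast

lemma
  assumes "subspace U"
  shows ext_rel_zero: "0 \<in> ext_rel k U"
    and ext_rel_add: "f \<in> ext_rel k U \<Longrightarrow> g \<in> ext_rel k U \<Longrightarrow> f + g \<in> ext_rel k U"
    and ext_rel_uminus: "f \<in> ext_rel k U \<Longrightarrow> - f \<in> ext_rel k U"
proof -
  interpret R: subgroup "ext_rel k U" "tuple_space k U"
    by (rule subgroup_exterior_relations[OF vector_space_axioms assms])
  show "0 \<in> ext_rel k U" using R.one_closed by simp
  show "f + g \<in> ext_rel k U" if "f \<in> ext_rel k U" "g \<in> ext_rel k U"
    using R.m_closed[OF that] by simp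
  show "- f \<in> ext_rel k U" if "f \<in> ext_rel k U"
    using R.m_inv_closed[OF that] tuple_space_inv[OF subsetD[OF R.subset that]] by simp
qed

lemma ext_rel_diff:
  "subspace U \<Longrightarrow> f \<in> ext_rel k U \<Longrightarrow> g \<in> ext_rel k U \<Longrightarrow> f - g \<in> ext_rel k U"
  using ext_rel_add[of U f k "- g"] ext_rel_uminus by simp

lemma ext_rel_sum:
  "subspace U \<Longrightarrow> (\<And>i. i \<in> I \<Longrightarrow> f i \<in> ext_rel k U) \<Longrightarrow> sum f I \<in> ext_rel k U"
  by (induction I rule: infinite_finite_induct) (simp_all add: ext_rel_zero ext_rel_add)

lemma ext_rel_mono:
  "subspace U \<Longrightarrow> subspace W \<Longrightarrow> U \<subseteq> W \<Longrightarrow> f \<in> ext_rel k U \<Longrightarrow> f \<in> ext_rel k W"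
  using exterior_relations_mono[OF vector_space_axioms] by blast

lemma ext_rel_multilinear:
  assumes "length xs + 1 + length ys = k" "set xs \<subseteq> U" "set ys \<subseteq> U" "u \<in> U" "v \<in> U"
  shows "Poly_Mapping.single (xs @ [scale a u + scale b v] @ ys) c
        - Poly_Mapping.single (xs @ [u] @ ys) (c * a)
        - Poly_Mapping.single (xs @ [v] @ ys) (c * b) \<in> ext_rel k U"
  unfolding exterior_relations_def multilinear_relations_def
  by (rule generate.incl) (use assms in blast)

lemma ext_rel_alternating:
  assumes "length xs = k" "set xs \<subseteq> U" "\<not> distinct xs"
  shows "Poly_Mapping.single xs c \<in> ext_rel k U"
  unfolding exterior_relations_def alternating_relations_def
  by (rule generate.incl) (use assms in blast)

text \<open>The relations are generated with the operations of \<open>tuple_space\<close>; this form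
  speaks of \<open>+\<close> and \<open>-\<close> on formal sums, so that additive extensions can be
  checked generator by generator.\<close>

lemma ext_rel_induct [consumes 2, case_names zero multilinear alternating uminus add]:
  assumes "subspace U" "f \<in> ext_rel k U"
    and "P 0"
    and "\<And>xs ys u v a b c. length xs + 1 + length ys = k \<Longrightarrow> set xs \<subseteq> U \<Longrightarrow> set ys \<subseteq> U \<Longrightarrow> u \<in> U \<Longrightarrow> v \<in> U \<Longrightarrow>
      P (Poly_Mapping.single (xs @ [scale a u + scale b v] @ ys) c
        - Poly_Mapping.single (xs @ [u] @ ys) (c * a)
        - Poly_Mapping.single (xs @ [v] @ ys) (c * b))"
    and "\<And>xs c. length xs = k \<Longrightarrow> set xs \<subseteq> U \<Longrightarrow> \<not> distinct xs \<Longrightarrow> P (Poly_Mapping.single xs c)"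
    and uminus: "\<And>f. P f \<Longrightarrow> P (- f)"
    and add: "\<And>f g. P f \<Longrightarrow> P g \<Longrightarrow> P (f + g)"
  shows "P f"
proof -
  have gen: "P h" if "h \<in> multilinear_relations scale k U \<union> alternating_relations k U" for h
    using that assms(4,5) unfolding multilinear_relations_def alternating_relations_def by blast
  have "f \<in> generate (tuple_space k U) (multilinear_relations scale k U \<union> alternating_relations k U)"
    using assms(2) by (simp add: exterior_relations_def)
  then show ?thesis
  proof induction
    case one
    then show ?case using assms(3) by simp
  next
    case (incl h)
    then show ?case by (rule gen)
  next
    case (inv h)
    then have "h \<in> tuples k U"
      using relations_in_tuple_space[OF vector_space_axioms assms(1)] by blast
    then show ?case using uminus[OF gen[OF inv]] by (simp add: tuple_space_inv)
  next
    case (eng h1 h2)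
    then show ?case using add by simp
  qed
qed

text \<open>Functoriality of the exterior power: generators go to generators, since repeated entries
  stay repeated under \<open>T\<close>.\<close>

lemma tuple_map_ext_rel:
  assumes T: "Vector_Spaces.linear scale scale T" and U: "subspace U" and W: "subspace W"
    and TU: "T ` U \<subseteq> W" and f: "f \<in> ext_rel k U"
  shows "tuple_map T f \<in> ext_rel k W"
proof -
  interpret T: Vector_Spaces.linear scale scale T by fact
  note ext_simps = finsupp_ext_add[where h = "\<lambda>xs. Poly_Mapping.single (map T xs)"]
    finsupp_ext_uminus[where h = "\<lambda>xs. Poly_Mapping.single (map T xs)"]
    finsupp_ext_diff[where h = "\<lambda>xs. Poly_Mapping.single (map T xs)"]
    finsupp_ext_single[where h = "\<lambda>xs. Poly_Mapping.single (map T xs)"] single_add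
  show ?thesis
    using U f
  proof (induction rule: ext_rel_induct)
    case (multilinear xs ys u v a b c)
    then show ?case
      using ext_rel_multilinear[of "map T xs" "map T ys" k W "T u" "T v" a b c] TU
      by (auto simp: ext_simps T.add T.scale)
  next
    case (alternating xs c)
    then have "\<not> distinct (map T xs)" by (auto simp: distinct_map)
    with alternating show ?case
      using TU by (simp add: ext_simps) (intro ext_rel_alternating; auto)
  qed (simp_all add: W ext_simps ext_rel_zero ext_rel_add ext_rel_uminus)
qed

lemma tuple_det_ext_rel:
  assumes \<phi>: "\<And>j. Vector_Spaces.linear scale (*) (\<phi> j)" and U: "subspace U" and f: "f \<in> ext_rel k U"
  shows "finsupp_ext (\<lambda>xs c. c * tuple_det \<phi> xs) f = 0"
proof -
  note ext_simps = finsupp_ext_add[where h = "\<lambda>xs c. c * tuple_det \<phi> xs"]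
    finsupp_ext_uminus[where h = "\<lambda>xs c. c * tuple_det \<phi> xs"]
    finsupp_ext_diff[where h = "\<lambda>xs c. c * tuple_det \<phi> xs"]
    finsupp_ext_single[where h = "\<lambda>xs c. c * tuple_det \<phi> xs"] algebra_simps
  show ?thesis
    using U f
  proof (induction rule: ext_rel_induct)
    case (multilinear xs ys u v a b c)
    have "\<phi> j (scale a u + scale b v) = a * \<phi> j u + b * \<phi> j v" for j
      using \<phi>[of j] by (simp add: Vector_Spaces.linear_iff)
    from tuple_det_linear[of \<phi>, OF this] show ?case by (simp add: ext_simps)
  qed (simp_all add: ext_simps tuple_det_not_distinct)
qed

text \<open>The functionals dual to \<open>xs\<close> give the identity matrix, whose determinant is
  nonzero, whereas every relation evaluates to 0.\<close>

lemma single_not_ext_rel: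
  assumes \<phi>: "\<And>j. Vector_Spaces.linear scale (*) (\<phi> j)" and U: "subspace U"
    and dual: "\<And>i j. i < length xs \<Longrightarrow> j < length xs \<Longrightarrow> \<phi> j (xs ! i) = (if i = j then 1 else 0)"
  shows "Poly_Mapping.single xs 1 \<notin> ext_rel k U"
proof
  assume "Poly_Mapping.single xs 1 \<in> ext_rel k U"
  then have "tuple_det \<phi> xs = 0"
    using tuple_det_ext_rel[of \<phi>, OF \<phi> U] by (fastforce simp: finsupp_ext_single)
  moreover have "mat (length xs) (length xs) (\<lambda>(i, j). \<phi> j (xs ! i)) = 1\<^sub>m (length xs)"
    using dual by (intro eq_matI) auto
  ultimately show False by (simp add: tuple_det_def)
qed

text \<open>Expanding \<open>v\<close> in the other entries leaves only tuples with a repeated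
  entry.\<close>

lemma single_span_ext_rel:
  assumes U: "subspace U" and len: "length xs + 1 + length ys = k"
    and sub: "set xs \<subseteq> U" "set ys \<subseteq> U" and v: "v \<in> span (set (xs @ ys))"
  shows "Poly_Mapping.single (xs @ [v] @ ys) c \<in> ext_rel k U"
proof -
  \<comment> \<open>The induction needs all coefficients at once, because a scalar of the linear
    combination is absorbed into \<open>c\<close>; membership in \<open>U\<close> is what allows the
    next multilinear relation.\<close>
  have "v \<in> U \<and> (\<forall>c. Poly_Mapping.single (xs @ [v] @ ys) c \<in> ext_rel k U)"
    using v
  proof (induction rule: span_induct_alt)
    case base
    have 0: "0 \<in> U" using U by (rule subspace_0)
    show ?case
      using ext_rel_multilinear[OF len sub 0 0, of 0 0] 0 by simp
  next
    case (step a x y)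
    have x: "x \<in> U" using step sub by auto
    have "\<not> distinct (xs @ [x] @ ys)" using step by auto
    then have "Poly_Mapping.single (xs @ [x] @ ys) (c * a) \<in> ext_rel k U" for c
      using len sub x by (intro ext_rel_alternating) auto
    moreover have "Poly_Mapping.single (xs @ [y] @ ys) c \<in> ext_rel k U" for c
      using step by blast
    moreover have "Poly_Mapping.single (xs @ [scale a x + y] @ ys) c
        - Poly_Mapping.single (xs @ [x] @ ys) (c * a)
        - Poly_Mapping.single (xs @ [y] @ ys) c \<in> ext_rel k U" for c
      using ext_rel_multilinear[OF len sub x, of y a 1 c] step by simp
    ultimately have "Poly_Mapping.single (xs @ [scale a x + y] @ ys) c
        - Poly_Mapping.single (xs @ [x] @ ys) (c * a) - Poly_Mapping.single (xs @ [y] @ ys) c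
        + Poly_Mapping.single (xs @ [x] @ ys) (c * a) + Poly_Mapping.single (xs @ [y] @ ys) c \<in> ext_rel k U" for c
      by (intro ext_rel_add U)
    then show ?case
      using U x step by (simp add: subspace_add subspace_scale)
  qed
  then show ?thesis by blast
qed

text \<open>The \<open>k\<close>-th exterior power vanishes above the dimension: \<open>k\<close>
  distinct vectors of \<open>U\<close> are dependent, so one entry lies in the span of the
  others.\<close>

lemma ext_rel_eq_tuples:
  assumes U: "subspace U" and dim: "dim U < k"
  shows "ext_rel k U = tuples k U"
proof (intro subset_antisym ext_rel_subset U subsetI)
  have single: "Poly_Mapping.single xs c \<in> ext_rel k U" if xs: "length xs = k" "set xs \<subseteq> U" for xs c
  proof (cases "distinct xs")
    case True
    have "dependent (set xs)"
      using independent_card_le_dim[of "set xs" U] xs True dim by (auto simp: distinct_card)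
    then obtain v where v: "v \<in> set xs" "v \<in> span (set xs - {v})"
      by (auto simp: dependent_def)
    obtain ys zs where s: "xs = ys @ [v] @ zs" using v(1) split_list by fastforce
    with True have "set xs - {v} = set (ys @ zs)" by auto
    then show ?thesis
      using v xs s single_span_ext_rel[OF U, of ys zs k v c] by auto
  qed (use ext_rel_alternating xs in blast)
  fix f :: "'b list \<Rightarrow>\<^sub>0 'a" assume f: "f \<in> tuples k U"
  have "f = (\<Sum>xs\<in>Poly_Mapping.keys f. Poly_Mapping.single xs (Poly_Mapping.lookup f xs))"
    by (rule poly_mapping_eqI) (auto simp: lookup_sum lookup_single when_def in_keys_iff sum.delta)
  also have "\<dots> \<in> ext_rel k U"
    using f by (intro ext_rel_sum U single) auto
  finally show "f \<in> ext_rel k U" .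
qed

lemma tuple_map_id:
  assumes "\<And>x. x \<in> U \<Longrightarrow> T x = x" "f \<in> tuples k U"
  shows "tuple_map T f = f"
proof -
  have "tuple_map T f = (\<Sum>xs\<in>Poly_Mapping.keys f. Poly_Mapping.single xs (Poly_Mapping.lookup f xs))"
    unfolding finsupp_ext_def using assms
    by (intro sum.cong refl arg_cong[where f = "\<lambda>xs. Poly_Mapping.single xs _"] map_idI) auto
  also have "\<dots> = f"
    by (rule poly_mapping_eqI) (auto simp: lookup_sum lookup_single when_def in_keys_iff sum.delta)
  finally show ?thesis .
qed

lemma tuple_map_tuples:
  assumes "f \<in> tuples k U" "T ` U \<subseteq> W"
  shows "tuple_map T f \<in> tuples k W"
  unfolding finsupp_ext_def using assms
  by (intro tuples_sum tuples_single) (simp_all, blast+)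

text \<open>A basis of \<open>H\<close> stays independent when \<open>z\<close> is added, so the map
  may fix \<open>H\<close> and still be prescribed at \<open>z\<close>. Killing a chosen
  \<open>z\<close> is what later shrinks a second subspace.\<close>

lemma linear_retraction:
  assumes H: "subspace H" and z: "z \<notin> H"
  obtains T where "Vector_Spaces.linear scale scale T" "\<And>x. x \<in> H \<Longrightarrow> T x = x" "range T = H" "T z = 0"
proof -
  interpret vector_space_pair scale scale by unfold_locales
  obtain B where B: "finite B" "B \<subseteq> H" "independent B" "span B = H"
    using basis_subspace_exists[OF H] by metis
  have zB: "z \<notin> B" using B z by blast
  have "independent (insert z B)"
    using B z by (intro independent_insertI) auto
  from linear_independent_extend_subspace[OF this, of "\<lambda>x. if x = z then 0 else x"]
  obtain T where T: "Vector_Spaces.linear scale scale T" "\<forall>x\<in>insert z B. T x = (if x = z then 0 else x)"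
    "range T = span ((\<lambda>x. if x = z then 0 else x) ` insert z B)" by blast
  have "(\<lambda>x. if x = z then 0 else x) ` insert z B = insert 0 B" using zB by force
  then have "range T = H" using T(3) B by simp
  moreover have "T x = x" if "x \<in> H" for x
    using linear_eq_on[OF T(1) linear_id, of x B] B that T(2) zB by fastforce
  ultimately show ?thesis using that T by auto
qed

text \<open>Injectivity of the map of exterior powers induced by an inclusion: a retraction onto
  \<open>H\<close> induces a left inverse.\<close>

lemma ext_rel_restrict:
  assumes H: "subspace H" "H \<subseteq> W" and W: "subspace W" and f: "f \<in> tuples k H" "f \<in> ext_rel k W"
  shows "f \<in> ext_rel k H"
proof (cases "H = UNIV")
  case False
  then obtain z where "z \<notin> H" by blast
  from linear_retraction[OF H(1) this] obtain T where
    T: "Vector_Spaces.linear scale scale T" "\<And>x. x \<in> H \<Longrightarrow> T x = x" "range T = H" by metis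
  have "tuple_map T f \<in> ext_rel k H"
    using T f H W by (intro tuple_map_ext_rel[of T W]) auto
  then show ?thesis using tuple_map_id[OF T(2) f(1)] by simp
qed (use assms in \<open>auto simp: top.extremum_unique\<close>)

text \<open>Project onto \<open>H\<close> along a vector of \<open>H'\<close>: the image of \<open>H'\<close> then has dimension less than \<open>k\<close>.\<close>

lemma ext_rel_add_restrict:
  assumes H: "subspace H" "H \<subseteq> W" and H': "subspace H'" "H' \<subseteq> W" "dim H' \<le> k" "\<not> H' \<subseteq> H"
    and W: "subspace W" and f: "f \<in> tuples k H" and g: "g \<in> tuples k H'" and fg: "f + g \<in> ext_rel k W"
  shows "f \<in> ext_rel k H"
proof -
  obtain z where z: "z \<in> H'" "z \<notin> H" using H' by blast
  from linear_retraction[OF H(1) z(2)] obtain T where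
    T: "Vector_Spaces.linear scale scale T" "\<And>x. x \<in> H \<Longrightarrow> T x = x" "range T = H" "T z = 0" by metis
  interpret T: Vector_Spaces.linear scale scale T by fact
  have "independent {z}" using z H(1) subspace_0 by auto
  then obtain C where C: "z \<in> C" "C \<subseteq> H'" "independent C" "H' \<subseteq> span C"
    using maximal_independent_subset_extend[of "{z}" H'] z by auto
  have finC: "finite C" using C finiteI_independent by blast
  have "card C = dim H'" using C basis_card_eq_dim by blast
  then have "card (T ` (C - {z})) < k"
    using card_image_le[of "C - {z}" T] finC C(1) H'(3) card_gt_0_iff[of C] by auto
  moreover have "dim (T ` H') \<le> card (T ` (C - {z}))"
  proof (rule dim_le_card)
    have "T ` H' \<subseteq> span (T ` C)"
      using C(4) T.span_image[of C] by auto
    also have "T ` C = insert 0 (T ` (C - {z}))" using C(1) T(4) by force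
    finally show "T ` H' \<subseteq> span (T ` (C - {z}))" by simp
  qed (use finC in simp)
  ultimately have dim: "dim (T ` H') < k" by linarith
  have sT: "subspace (T ` H')" using H'(1) by (rule T.subspace_image)
  have "tuple_map T g \<in> ext_rel k (T ` H')"
    using tuple_map_tuples[OF g] ext_rel_eq_tuples[OF sT dim] by blast
  then have g': "tuple_map T g \<in> ext_rel k H"
    using T(3) by (intro ext_rel_mono[OF sT H(1)]) auto
  have "tuple_map T (f + g) \<in> ext_rel k H"
    using T fg H W by (intro tuple_map_ext_rel[of T W]) auto
  moreover have "tuple_map T (f + g) = f + tuple_map T g"
    using tuple_map_id[OF T(2) f] by (simp add: finsupp_ext_add single_add)
  ultimately show ?thesis
    using ext_rel_diff[OF H(1), of "f + tuple_map T g" k "tuple_map T g"] g' by simp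
qed

end

section \<open>Sets of flags with the exchange property\<close>

text \<open>The recursion shared by the lower bound and the construction; halving is exact because
  the factorial is even.\<close>

lemma half_fact_Suc: "(m + 3) * (fact (m + 2) div 2) = (fact (Suc m + 2) :: nat) div 2"
proof -
  have "(2::nat) dvd fact (m + 2)" by (rule dvd_fact) auto
  then have "(m + 3) * (fact (m + 2) div 2) = (m + 3) * fact (m + 2) div 2" by (rule div_mult_swap)
  also have "(m + 3) * fact (m + 2) = (fact (Suc (m + 2)) :: nat)"
    by (metis fact_Suc of_nat_id add_Suc_right numeral_2_eq_2 numeral_3_eq_3)
  finally show ?thesis by (simp only: add_Suc)
qed

context exterior_space
begin

text \<open>Stated without the ambient dimension, so that a flag with its top member removed is
  again of this kind, with the same \<open>k\<close> and smaller \<open>m\<close>.\<close>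

definition full_flag :: "nat \<Rightarrow> nat \<Rightarrow> 'b set set \<Rightarrow> bool" where
  "full_flag k m \<sigma> \<longleftrightarrow> finite \<sigma> \<and> card \<sigma> = m \<and> dim ` \<sigma> = {k..<k + m} \<and> (\<forall>U\<in>\<sigma>. subspace U)
     \<and> chain\<^sub>\<subseteq> \<sigma>"

lemma full_flag_dim_inj:
  assumes "full_flag k m \<sigma>" "U \<in> \<sigma>" "W \<in> \<sigma>" "dim U = dim W"
  shows "U = W"
proof -
  have "inj_on dim \<sigma>"
    using assms(1) by (intro eq_card_imp_inj_on) (auto simp: full_flag_def)
  then show ?thesis using assms(2-4) by (auto dest: inj_onD)
qed

lemma full_flag_dim_less_imp_subset:
  assumes "full_flag k m \<sigma>" "U \<in> \<sigma>" "W \<in> \<sigma>" "dim U \<le> dim W"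
  shows "U \<subseteq> W"
proof (cases "dim U = dim W")
  case False
  then have "\<not> W \<subseteq> U" using dim_subset[of W U] assms(4) by auto
  then show ?thesis using assms(1-3) unfolding full_flag_def chain_subset_def by blast
qed (use full_flag_dim_inj assms in blast)

lemma full_flag_remove_top:
  assumes "full_flag k (Suc m) \<sigma>" "H \<in> \<sigma>" "dim H = k + m"
  shows "full_flag k m (\<sigma> - {H})"
proof -
  have flag: "finite \<sigma>" "card \<sigma> = Suc m" "dim ` \<sigma> = {k..<k + Suc m}" "\<forall>U\<in>\<sigma>. subspace U"
    "chain\<^sub>\<subseteq> \<sigma>"
    using assms(1) by (auto simp: full_flag_def)
  have "inj_on dim \<sigma>" using flag by (intro eq_card_imp_inj_on) simp_all
  then have "dim ` (\<sigma> - {H}) = dim ` \<sigma> - dim ` {H}"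
    using assms(2) by (intro inj_on_image_set_diff[of dim \<sigma>]) auto
  also have "\<dots> = {k..<k + m}" unfolding flag(3) using assms(3) by auto
  finally have "dim ` (\<sigma> - {H}) = {k..<k + m}" .
  moreover have "card (\<sigma> - {H}) = m" using flag(1,2) assms(2) by simp
  ultimately show ?thesis using flag(1,4,5) by (auto simp: full_flag_def chain_subset_def)
qed

text \<open>Both flags realise the same dimensions, each once, and the remaining members leave only
  \<open>dim U\<close> open.\<close>

lemma full_flag_exchange_dim:
  assumes "full_flag k m \<sigma>" "U \<in> \<sigma>" "full_flag k m (insert U' (\<sigma> - {U}))"
  shows "dim U' = dim U" "U' \<notin> \<sigma> - {U}"
proof -
  have fin: "finite \<sigma>" and card: "card \<sigma> = m" using assms(1) by (auto simp: full_flag_def)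
  show "U' \<notin> \<sigma> - {U}"
  proof
    assume "U' \<in> \<sigma> - {U}"
    then have "card (\<sigma> - {U}) = m"
      using assms(3) by (simp add: full_flag_def insert_absorb)
    then show False using fin card assms(2) card_gt_0_iff[of \<sigma>] by auto
  qed
  have "dim U \<in> dim ` insert U' (\<sigma> - {U})"
    using assms by (metis full_flag_def imageI)
  then show "dim U' = dim U"
    using full_flag_dim_inj[OF assms(1) assms(2)] by auto
qed

text \<open>The combinatorial trace of the cycle condition. By the second clause, at least three
  members, counting \<open>U\<close>, complete a flag whose bottom has been removed.\<close>

definition exchangeable :: "nat \<Rightarrow> 'b set set set \<Rightarrow> bool" where
  "exchangeable k S \<longleftrightarrow>
     (\<forall>\<sigma>\<in>S. \<forall>U\<in>\<sigma>. \<exists>U'. U' \<noteq> U \<and> insert U' (\<sigma> - {U}) \<in> S) \<and>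
     (\<forall>\<sigma>\<in>S. \<forall>U\<in>\<sigma>. dim U = k \<longrightarrow> (\<exists>U' U''. U' \<noteq> U \<and> U'' \<noteq> U \<and> U' \<noteq> U'' \<and>
        insert U' (\<sigma> - {U}) \<in> S \<and> insert U'' (\<sigma> - {U}) \<in> S))"

lemma exchangeableE:
  assumes "exchangeable k S" "\<sigma> \<in> S" "U \<in> \<sigma>"
  obtains U' where "U' \<noteq> U" "insert U' (\<sigma> - {U}) \<in> S"
proof -
  have "\<forall>\<sigma>\<in>S. \<forall>U\<in>\<sigma>. \<exists>U'. U' \<noteq> U \<and> insert U' (\<sigma> - {U}) \<in> S"
    using assms(1) unfolding exchangeable_def by (rule conjunct1)
  from bspec[OF bspec[OF this assms(2)] assms(3)] show ?thesis using that by (elim exE conjE)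
qed

lemma exchangeable_bottomE:
  assumes "exchangeable k S" "\<sigma> \<in> S" "U \<in> \<sigma>" "dim U = k"
  obtains U' U'' where "U' \<noteq> U" "U'' \<noteq> U" "U' \<noteq> U''"
    "insert U' (\<sigma> - {U}) \<in> S" "insert U'' (\<sigma> - {U}) \<in> S"
proof -
  have "\<forall>\<sigma>\<in>S. \<forall>U\<in>\<sigma>. dim U = k \<longrightarrow> (\<exists>U' U''. U' \<noteq> U \<and> U'' \<noteq> U \<and> U' \<noteq> U'' \<and>
        insert U' (\<sigma> - {U}) \<in> S \<and> insert U'' (\<sigma> - {U}) \<in> S)"
    using assms(1) unfolding exchangeable_def by (rule conjunct2)
  from mp[OF bspec[OF bspec[OF this assms(2)] assms(3)] assms(4)] show ?thesis
    using that by (elim exE conjE)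
qed

text \<open>An exchange of a member other than \<open>H\<close> keeps \<open>H\<close>, so it
  survives in the link. As \<open>H\<close> is the top, the link consists of shorter full flags with
  the same bottom dimension.\<close>

lemma exchangeable_link:
  assumes flags: "\<And>\<sigma>. \<sigma> \<in> S \<Longrightarrow> full_flag k (Suc m) \<sigma>" and ex: "exchangeable k S"
    and H: "dim H = k + m"
  shows "exchangeable k ((\<lambda>\<sigma>. \<sigma> - {H}) ` {\<sigma> \<in> S. H \<in> \<sigma>})"
proof -
  let ?L = "(\<lambda>\<sigma>. \<sigma> - {H}) ` {\<sigma> \<in> S. H \<in> \<sigma>}"
  have *: "insert U' (\<sigma> - {H} - {U}) \<in> ?L"
    if "\<sigma> \<in> S" "H \<in> \<sigma>" "U \<in> \<sigma>" "U \<noteq> H" "insert U' (\<sigma> - {U}) \<in> S" for \<sigma> U U'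
  proof -
    have "U' \<noteq> H"
      using full_flag_exchange_dim(2)[OF flags[OF that(1)] that(3) flags[OF that(5)]] that by blast
    then have "insert U' (\<sigma> - {H} - {U}) = insert U' (\<sigma> - {U}) - {H}" using that by blast
    moreover have "insert U' (\<sigma> - {U}) \<in> {\<sigma> \<in> S. H \<in> \<sigma>}" using that by auto
    ultimately show ?thesis by (rule image_eqI)
  qed
  show ?thesis
    unfolding exchangeable_def
  proof (intro conjI ballI impI)
    fix \<tau> U assume "\<tau> \<in> ?L" "U \<in> \<tau>"
    then obtain \<sigma> where \<sigma>: "\<sigma> \<in> S" "H \<in> \<sigma>" "\<tau> = \<sigma> - {H}" "U \<in> \<sigma>" "U \<noteq> H" by blast
    obtain U' where U': "U' \<noteq> U" "insert U' (\<sigma> - {U}) \<in> S"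
      using exchangeableE[OF ex \<sigma>(1,4)] .
    show "\<exists>U'. U' \<noteq> U \<and> insert U' (\<tau> - {U}) \<in> ?L"
      unfolding \<sigma>(3) by (rule exI[of _ U']) (rule conjI[OF U'(1) *[OF \<sigma>(1,2,4,5) U'(2)]])
  next
    fix \<tau> U assume "\<tau> \<in> ?L" "U \<in> \<tau>" and dim: "dim U = k"
    then obtain \<sigma> where \<sigma>: "\<sigma> \<in> S" "H \<in> \<sigma>" "\<tau> = \<sigma> - {H}" "U \<in> \<sigma>" "U \<noteq> H" by blast
    obtain U' U'' where U': "U' \<noteq> U" "U'' \<noteq> U" "U' \<noteq> U''"
      "insert U' (\<sigma> - {U}) \<in> S" "insert U'' (\<sigma> - {U}) \<in> S"
      using exchangeable_bottomE[OF ex \<sigma>(1,4) dim] .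
    show "\<exists>U' U''. U' \<noteq> U \<and> U'' \<noteq> U \<and> U' \<noteq> U'' \<and> insert U' (\<tau> - {U}) \<in> ?L \<and> insert U'' (\<tau> - {U}) \<in> ?L"
      unfolding \<sigma>(3) using U'(1-3) *[OF \<sigma>(1,2,4,5) U'(4)] *[OF \<sigma>(1,2,4,5) U'(5)]
      by (intro exI[of _ U'] exI[of _ U''] conjI)
  qed
qed

text \<open>
  Counting hyperplanes: each of the codimension-two spaces occurring below a fixed top member lies in
  a further top member, and these are distinct because two distinct top members meet in at most
  one space of codimension two.
\<close>

lemma exchangeable_card_ge:
  assumes "finite S" "S \<noteq> {}" "\<And>\<sigma>. \<sigma> \<in> S \<Longrightarrow> full_flag k m \<sigma>" "exchangeable k S" "m \<ge> 1"
  shows "fact (m + 2) div 2 \<le> card S \<and> m + 2 \<le> card {H \<in> \<Union>S. dim H = k + m - 1}"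
  using assms(5,1-4)
proof (induction m arbitrary: S rule: dec_induct)
  case base
  then obtain \<sigma> where \<sigma>: "\<sigma> \<in> S" by blast
  then have "card \<sigma> = 1" "dim ` \<sigma> = {k}" using base(3)[OF \<sigma>] by (auto simp: full_flag_def)
  then obtain U where U: "\<sigma> = {U}" "dim U = k" by (auto simp: card_1_singleton_iff)
  \<comment> \<open>Double exchange at the bottom gives three one-member flags;
    \<open>fact 3 div 2\<close> and \<open>m + 2\<close> are both 3 here.\<close>
  then obtain U' U'' where ne: "U' \<noteq> U" "U'' \<noteq> U" "U' \<noteq> U''" and mem: "{U'} \<in> S" "{U''} \<in> S"
    using base(4) \<sigma> unfolding exchangeable_def by (metis Diff_cancel insertI1)
  have dims: "dim U' = k" "dim U'' = k"
    using base(3)[OF mem(1)] base(3)[OF mem(2)] by (auto simp: full_flag_def)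
  have fin: "finite (\<Union>S)" using base(1,3) by (auto simp: full_flag_def)
  have "card {{U}, {U'}, {U''}} \<le> card S"
    using \<sigma> U mem base(1) by (intro card_mono) auto
  moreover have "card {U, U', U''} \<le> card {H \<in> \<Union>S. dim H = k + 1 - 1}"
    using \<sigma> U mem dims fin by (intro card_mono finite_subset[OF _ fin]) auto
  ultimately show ?case using ne by (simp add: fact_numeral)
next
  case (step m S)
  note fin = step.prems(1) and flags = step.prems(3) and ex = step.prems(4)
  define T where "T = {H \<in> \<Union>S. dim H = k + m}"
  define L where "L H = (\<lambda>\<sigma>. \<sigma> - {H}) ` {\<sigma> \<in> S. H \<in> \<sigma>}" for H
  have finT: "finite T" using fin flags by (auto simp: T_def full_flag_def)
  have top: "\<exists>H. H \<in> \<sigma> \<and> dim H = k + m" if "\<sigma> \<in> S" for \<sigma>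
  proof -
    have "k + m \<in> dim ` \<sigma>" using flags[OF that] by (auto simp: full_flag_def)
    then show ?thesis by (auto simp: image_iff)
  qed
  have IH: "fact (m + 2) div 2 \<le> card (L H)"
    "m + 2 \<le> card {W \<in> \<Union>(L H). dim W = k + m - 1}" if "H \<in> T" for H
  proof -
    have dimH: "dim H = k + m" and ne: "L H \<noteq> {}" and finL: "finite (L H)"
      using that fin by (auto simp: T_def L_def)
    have "full_flag k m \<tau>" if "\<tau> \<in> L H" for \<tau>
      using that full_flag_remove_top[OF flags] dimH by (auto simp: L_def)
    moreover have "exchangeable k (L H)"
      using exchangeable_link[OF flags ex dimH] by (simp add: L_def)
    ultimately show "fact (m + 2) div 2 \<le> card (L H)"
      "m + 2 \<le> card {W \<in> \<Union>(L H). dim W = k + m - 1}"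
      using step.IH[OF finL ne] by auto
  qed
  have cardL: "card (L H) = card {\<sigma> \<in> S. H \<in> \<sigma>}" for H
    unfolding L_def by (rule card_image) (auto simp: inj_on_def)
  obtain \<sigma>0 H0 where \<sigma>0: "\<sigma>0 \<in> S" "H0 \<in> \<sigma>0" "dim H0 = k + m"
    using step.prems(2) top by blast
  have H0: "H0 \<in> T" using \<sigma>0 by (auto simp: T_def)
  define T0 where "T0 = {W \<in> \<Union>(L H0). dim W = k + m - 1}"
  \<comment> \<open>Exchanging \<open>H0\<close> in a flag through \<open>W\<close> keeps
    \<open>W\<close>, and the replacement, again of the largest dimension, contains it.\<close>
  have "\<exists>H'. H' \<in> T - {H0} \<and> W \<subseteq> H'" if W: "W \<in> T0" for W
  proof -
    obtain \<sigma> where \<sigma>: "\<sigma> \<in> S" "H0 \<in> \<sigma>" "W \<in> \<sigma>" "W \<noteq> H0"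
      using W by (auto simp: T0_def L_def)
    obtain H' where H': "H' \<noteq> H0" "insert H' (\<sigma> - {H0}) \<in> S"
      using exchangeableE[OF ex \<sigma>(1,2)] .
    then have "dim H' = k + m"
      using full_flag_exchange_dim(1)[OF flags[OF \<sigma>(1)] \<sigma>(2) flags[OF H'(2)]] \<sigma>0 by simp
    moreover have "W \<subseteq> H'"
      using full_flag_dim_less_imp_subset[OF flags[OF H'(2)], of W H'] \<sigma> W \<open>dim H' = k + m\<close>
      by (auto simp: T0_def)
    ultimately show ?thesis using H' unfolding T_def by (intro exI[of _ H']) blast
  qed
  then obtain g where g: "\<And>W. W \<in> T0 \<Longrightarrow> g W \<in> T - {H0}" "\<And>W. W \<in> T0 \<Longrightarrow> W \<subseteq> g W"
    by metis
  have sub: "subspace H" if "H \<in> T" for H using that flags by (auto simp: T_def full_flag_def)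
  have subT0: "subspace W" "W \<subseteq> H0" if W: "W \<in> T0" for W
  proof -
    obtain \<sigma> where \<sigma>: "\<sigma> \<in> S" "H0 \<in> \<sigma>" "W \<in> \<sigma>" using W by (auto simp: T0_def L_def)
    show "subspace W" using flags[OF \<sigma>(1)] \<sigma> by (auto simp: full_flag_def)
    show "W \<subseteq> H0"
      using full_flag_dim_less_imp_subset[OF flags[OF \<sigma>(1)] \<sigma>(3,2)] W \<sigma>0 by (auto simp: T0_def)
  qed
  have meet: "W = H0 \<inter> g W" if W: "W \<in> T0" for W
  proof (rule subspace_dim_equal)
    show "subspace W" "W \<subseteq> H0 \<inter> g W" using subT0[OF W] g(2)[OF W] by auto
    show s: "subspace (H0 \<inter> g W)" using sub H0 g(1)[OF W] by (intro subspace_inter) auto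
    have "H0 \<inter> g W \<noteq> H0"
      using subspace_dim_equal[OF sub[OF H0] sub, of "g W"] g(1)[OF W] \<sigma>0(3) by (auto simp: T_def)
    then have "dim (H0 \<inter> g W) < dim H0"
      using subspace_dim_equal[OF s sub[OF H0]] by fastforce
    then show "dim (H0 \<inter> g W) \<le> dim W" using W \<sigma>0 by (simp add: T0_def)
  qed
  have "inj_on g T0"
  proof (rule inj_onI)
    fix W W' assume "W \<in> T0" "W' \<in> T0" "g W = g W'"
    then show "W = W'" using meet[of W] meet[of W'] by (simp only:)
  qed
  then have "card T0 \<le> card (T - {H0})"
    using g(1) finT by (intro card_inj_on_le[of g]) auto
  moreover have "m + 2 \<le> card T0" using IH(2)[OF H0] by (simp add: T0_def)
  ultimately have cardT: "m + 3 \<le> card T" using finT H0 by (simp add: card_Diff_singleton)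
  \<comment> \<open>Each flag has exactly one member of dimension \<open>k + m\<close>, so
    \<open>S\<close> splits disjointly according to it, and each piece is as large as a
    link.\<close>
  have "(m + 3) * (fact (m + 2) div 2) \<le> card T * (fact (m + 2) div 2)"
    using cardT by (rule mult_right_mono) simp
  also have "\<dots> \<le> (\<Sum>H\<in>T. card {\<sigma> \<in> S. H \<in> \<sigma>})"
    using sum_bounded_below[of T "fact (m + 2) div 2" "\<lambda>H. card {\<sigma> \<in> S. H \<in> \<sigma>}"] IH(1) by (simp add: cardL)
  also have "\<dots> = card (\<Union>H\<in>T. {\<sigma> \<in> S. H \<in> \<sigma>})"
  proof (intro card_UN_disjoint[symmetric] ballI impI)
    fix H H' assume "H \<in> T" "H' \<in> T" "H \<noteq> H'"
    then have "\<not> (H \<in> \<sigma> \<and> H' \<in> \<sigma>)" if "\<sigma> \<in> S" for \<sigma>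
      using full_flag_dim_inj[OF flags[OF that], of H H'] by (auto simp: T_def)
    then show "{\<sigma> \<in> S. H \<in> \<sigma>} \<inter> {\<sigma> \<in> S. H' \<in> \<sigma>} = {}" by blast
  qed (use fin finT in auto)
  also have "\<dots> \<le> card S" using fin by (intro card_mono) auto
  finally have "(m + 3) * (fact (m + 2) div 2) \<le> card S" .
  moreover have "(m + 3) * (fact (m + 2) div 2) = (fact (Suc m + 2) :: nat) div 2"
    by (rule half_fact_Suc)
  ultimately have "fact (Suc m + 2) div 2 \<le> card S" by (simp only:)
  moreover have "Suc m + 2 \<le> card {H \<in> \<Union>S. dim H = k + Suc m - 1}"
    using cardT by (simp add: T_def)
  ultimately show ?case by (rule conjI)
qed

end

section \<open>A small cycle\<close>

definition signed :: "nat \<Rightarrow> 'x \<Rightarrow> 'x::ab_group_add" where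
  "signed i x = (if even i then x else - x)"

lemma signed_zero [simp]: "signed i 0 = 0"
  by (simp add: signed_def)

lemma signed_eq_0_iff [simp]: "signed i x = 0 \<longleftrightarrow> x = 0"
  by (simp add: signed_def)

lemma signed_signed: "signed i (signed j x) = signed (i + j) x"
  by (simp add: signed_def)

lemma signed_sum: "signed i (sum f A) = (\<Sum>x\<in>A. signed i (f x))"
  by (simp add: signed_def sum_negf)

text \<open>The two orders of each pair are cancelled against each other. Deducing only that the sum
  equals its own negative would be too weak in characteristic 2.\<close>

lemma sum_antisymmetric_eq_0:
  fixes t :: "'i::linorder \<Rightarrow> 'i \<Rightarrow> 'x::ab_group_add"
  assumes "finite B" "\<And>a a'. a \<in> B \<Longrightarrow> a' \<in> B \<Longrightarrow> a < a' \<Longrightarrow> t a' a = - t a a'"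
  shows "(\<Sum>a\<in>B. \<Sum>a'\<in>B - {a}. t a a') = 0"
proof -
  have "(\<Sum>a'\<in>B - {a}. t a a') = (\<Sum>a'\<in>{a'\<in>B. a < a'}. t a a') + (\<Sum>a'\<in>{a'\<in>B. a' < a}. t a a')" for a
    using assms(1) by (subst sum.union_disjoint[symmetric]) (auto intro!: sum.cong)
  then have "(\<Sum>a\<in>B. \<Sum>a'\<in>B - {a}. t a a')
      = (\<Sum>a\<in>B. \<Sum>a'\<in>{a'\<in>B. a < a'}. t a a') + (\<Sum>a\<in>B. \<Sum>a'\<in>{a'\<in>B. a' < a}. t a a')"
    by (simp add: sum.distrib)
  also have "(\<Sum>a\<in>B. \<Sum>a'\<in>{a'\<in>B. a' < a}. t a a') = (\<Sum>a'\<in>B. \<Sum>a\<in>{a\<in>B. a' < a}. t a a')"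
    using assms(1) by (intro sum.swap_restrict)
  also have "\<dots> = - (\<Sum>a\<in>B. \<Sum>a'\<in>{a'\<in>B. a < a'}. t a a')"
    unfolding sum_negf[symmetric] using assms(2) by (intro sum.cong) auto
  finally show ?thesis by simp
qed

definition rank_in :: "nat set \<Rightarrow> nat \<Rightarrow> nat" where
  "rank_in B a = card {b \<in> B. b < a}"

text \<open>The source of the sign change between the two orders of deletion: removing the smaller
  index shifts the rank of the larger one, but not conversely.\<close>

lemma rank_in_remove:
  assumes "finite B" "a \<in> B" "a < a'"
  shows "rank_in B a' = Suc (rank_in (B - {a}) a')" "rank_in (B - {a'}) a = rank_in B a"
proof -
  have "{b \<in> B. b < a'} = insert a {b \<in> B - {a}. b < a'}" using assms by auto
  then show "rank_in B a' = Suc (rank_in (B - {a}) a')"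
    using assms by (simp add: rank_in_def)
  have "{b \<in> B - {a'}. b < a} = {b \<in> B. b < a}" using assms by auto
  then show "rank_in (B - {a'}) a = rank_in B a" by (simp add: rank_in_def)
qed

text \<open>
  The model is the sum-zero hyperplane of an \<open>N\<close>-dimensional coordinate space: \<open>u b - u c\<close> plays
  the role of \<open>e\<^sub>b - e\<^sub>c\<close> and \<open>\<phi> a\<close> that of the \<open>a\<close>-th coordinate; \<open>\<kappa>\<close> spans a complement.
\<close>

locale general_position = exterior_space scale Basis
  for scale :: "'a::field \<Rightarrow> 'b::ab_group_add \<Rightarrow> 'b" and Basis +
  fixes N k :: nat and \<phi> \<psi> :: "nat \<Rightarrow> 'b \<Rightarrow> 'a" and u :: "nat \<Rightarrow> 'b" and \<kappa> :: "'b list"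
  assumes length_\<kappa>: "length \<kappa> + 1 = k"
    and linear_\<phi>: "\<And>a. Vector_Spaces.linear scale (*) (\<phi> a)"
    and linear_\<psi>: "\<And>j. Vector_Spaces.linear scale (*) (\<psi> j)"
    and \<phi>_u: "\<And>a b c. a < N \<Longrightarrow> b < N \<Longrightarrow> c < N \<Longrightarrow>
      \<phi> a (u b - u c) = (if a = b then 1 else 0) - (if a = c then 1 else 0)"
    and \<phi>_\<kappa>: "\<And>a x. a < N \<Longrightarrow> x \<in> set \<kappa> \<Longrightarrow> \<phi> a x = 0"
    and \<psi>_u: "\<And>j b c. j < length \<kappa> \<Longrightarrow> b < N \<Longrightarrow> c < N \<Longrightarrow> \<psi> j (u b - u c) = 0"
    and \<psi>_\<kappa>: "\<And>i j. i < length \<kappa> \<Longrightarrow> j < length \<kappa> \<Longrightarrow> \<psi> j (\<kappa> ! i) = (if i = j then 1 else 0)"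
begin

text \<open>In the model built in \<open>exists_general_position\<close>, a set of
  \<open>j + 2\<close> indices gives a space of dimension \<open>k + j\<close>: two indices give the
  bottom of a flag, all \<open>m + 2\<close> give the whole space.\<close>

definition coord_space :: "nat set \<Rightarrow> 'b set" where
  "coord_space B = {x. \<forall>a\<in>{..<N} - B. \<phi> a x = 0}"

lemma subspace_coord_space: "subspace (coord_space B)"
proof (rule subspaceI)
  have \<phi>: "\<phi> a 0 = 0" "\<phi> a (x + y) = \<phi> a x + \<phi> a y" "\<phi> a (scale c x) = c * \<phi> a x" for a x y c
    using linear_\<phi>[of a] Vector_Spaces.linear_iff[of scale "(*)" "\<phi> a"]
    by (auto dest: module_hom.zero simp: Vector_Spaces.linear.axioms linear_iff_module_hom)
  show "0 \<in> coord_space B" by (simp add: coord_space_def \<phi>)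
  show "x + y \<in> coord_space B" if "x \<in> coord_space B" "y \<in> coord_space B" for x y
    using that by (simp add: coord_space_def \<phi>)
  show "scale c x \<in> coord_space B" if "x \<in> coord_space B" for c x
    using that by (simp add: coord_space_def \<phi>)
qed

lemma coord_space_mono: "B \<subseteq> C \<Longrightarrow> coord_space B \<subseteq> coord_space C"
  by (auto simp: coord_space_def)

lemma coord_space_full: "coord_space {..<N} = UNIV"
  by (simp add: coord_space_def)

lemma \<kappa>_coord_space: "set \<kappa> \<subseteq> coord_space B"
  using \<phi>_\<kappa> by (auto simp: coord_space_def)

lemma diff_in_coord_space_iff:
  assumes "b < N" "c < N" "b \<noteq> c"
  shows "u b - u c \<in> coord_space B \<longleftrightarrow> b \<in> B \<and> c \<in> B"
  using assms \<phi>_u by (force simp: coord_space_def)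

lemma coord_space_remove_psubset:
  assumes "B \<subseteq> {..<N}" "a \<in> B" "card B \<ge> 2"
  shows "coord_space (B - {a}) \<subset> coord_space B"
proof -
  have "finite B" using assms(1) finite_subset by blast
  then have "card (B - {a}) > 0" using assms(2,3) by simp
  then obtain b where "b \<in> B" "b \<noteq> a" by (auto simp: card_gt_0_iff)
  then have "u a - u b \<in> coord_space B" "u a - u b \<notin> coord_space (B - {a})"
    using assms diff_in_coord_space_iff[of a b] by (blast, blast)
  then show ?thesis using coord_space_mono[of "B - {a}" B] by blast
qed

text \<open>A third index \<open>b\<close> is needed: \<open>u a - u b\<close> survives the removal
  of \<open>a'\<close> but not that of \<open>a\<close>.\<close>

lemma coord_space_remove_not_subset:
  assumes "B \<subseteq> {..<N}" "a \<in> B" "a' \<in> B" "a \<noteq> a'" "card B \<ge> 3"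
  shows "\<not> coord_space (B - {a'}) \<subseteq> coord_space (B - {a})"
proof -
  have "finite B" using assms(1) finite_subset by blast
  then have "card (B - {a, a'}) > 0" using assms by (simp add: card_Diff_subset)
  then obtain b where "b \<in> B" "b \<noteq> a" "b \<noteq> a'" by (auto simp: card_gt_0_iff)
  then have "u a - u b \<in> coord_space (B - {a'})" "u a - u b \<notin> coord_space (B - {a})"
    using assms diff_in_coord_space_iff[of a b] by (blast, blast)
  then show ?thesis by blast
qed

lemma coord_space_nonzero:
  assumes "B \<subseteq> {..<N}" "card B \<ge> 2"
  shows "coord_space B \<noteq> {0}"
proof -
  obtain a where "a \<in> B" using assms by fastforce
  have 0: "0 \<in> coord_space (B - {a})" by (rule subspace_0[OF subspace_coord_space])
  show ?thesis
  proof
    assume "coord_space B = {0}"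
    then have "coord_space (B - {a}) \<subset> {0}"
      using coord_space_remove_psubset[OF assms(1) \<open>a \<in> B\<close> assms(2)] by (simp only:)
    then show False using 0 by auto
  qed
qed

text \<open>Values are representatives, defined on arbitrary sets \<open>\<sigma>\<close>; removing
  the apex from \<open>\<sigma>\<close> gives the base of the cone. The start lives on the empty
  flag and is \<open>\<kappa>\<close> wedged with the difference of the two coordinate vectors of
  \<open>B\<close>. Orienting it from \<open>Min\<close> to \<open>Max\<close> makes the differences
  of three indices cancel with alternating signs.\<close>

primrec flag_cycle :: "nat \<Rightarrow> nat set \<Rightarrow> 'b set set \<Rightarrow> ('b list \<Rightarrow>\<^sub>0 'a)" where
  "flag_cycle 0 B \<sigma> = (if \<sigma> = {} then Poly_Mapping.single (\<kappa> @ [u (Max B) - u (Min B)]) 1 else 0)"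
| "flag_cycle (Suc j) B \<sigma> = (\<Sum>a\<in>B. if coord_space (B - {a}) \<in> \<sigma>
      then signed (rank_in B a) (flag_cycle j (B - {a}) (\<sigma> - {coord_space (B - {a})})) else 0)"

lemma flag_cycle_SucE:
  assumes "flag_cycle (Suc j) B \<sigma> \<noteq> 0"
  obtains a where "a \<in> B" "coord_space (B - {a}) \<in> \<sigma>" "flag_cycle j (B - {a}) (\<sigma> - {coord_space (B - {a})}) \<noteq> 0"
proof -
  have "\<exists>a\<in>B. (if coord_space (B - {a}) \<in> \<sigma>
      then signed (rank_in B a) (flag_cycle j (B - {a}) (\<sigma> - {coord_space (B - {a})})) else 0) \<noteq> 0"
  proof (rule ccontr)
    assume "\<not> ?thesis"
    then have "flag_cycle (Suc j) B \<sigma> = 0" by (auto intro!: sum.neutral)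
    then show False using assms by blast
  qed
  then show ?thesis using that by (auto split: if_splits)
qed

text \<open>One induction for all properties of a flag in the support. Strict inclusion in
  \<open>coord_space B\<close> matters most: it makes the apex of each cone a new vertex, lying
  above all vertices of the base.\<close>

lemma flag_cycle_nonzero_conj:
  assumes "B \<subseteq> {..<N}" "card B = j + 2" "flag_cycle j B \<sigma> \<noteq> 0"
  shows "finite \<sigma> \<and> card \<sigma> = j \<and> (\<forall>U\<in>\<sigma>. U \<subset> coord_space B)
    \<and> \<sigma> \<subseteq> coord_space ` {C. C \<subseteq> {..<N} \<and> 2 \<le> card C} \<and> chain\<^sub>\<subseteq> \<sigma>"
  using assms
proof (induction j arbitrary: B \<sigma>)
  case 0
  then show ?case by (auto simp: chain_subset_def split: if_splits)
next
  case (Suc j)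
  obtain a where a: "a \<in> B" "coord_space (B - {a}) \<in> \<sigma>"
    "flag_cycle j (B - {a}) (\<sigma> - {coord_space (B - {a})}) \<noteq> 0"
    using Suc.prems(3) by (rule flag_cycle_SucE)
  define W where "W = coord_space (B - {a})"
  define \<sigma>' where "\<sigma>' = \<sigma> - {W}"
  have \<sigma>: "\<sigma> = insert W \<sigma>'" "W \<notin> \<sigma>'" using a(2) by (auto simp: W_def \<sigma>'_def)
  have B': "B - {a} \<subseteq> {..<N}" "card (B - {a}) = j + 2"
    using Suc.prems a finite_subset[OF Suc.prems(1)] by auto
  have W: "W \<subset> coord_space B"
    using coord_space_remove_psubset[OF Suc.prems(1) a(1)] Suc.prems(2) by (simp add: W_def)
  have W': "W \<in> coord_space ` {C. C \<subseteq> {..<N} \<and> 2 \<le> card C}" using B' by (simp add: W_def)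
  from Suc.IH[OF B' a(3)] have IH: "finite \<sigma>'" "card \<sigma>' = j" "\<forall>U\<in>\<sigma>'. U \<subset> W"
    "\<sigma>' \<subseteq> coord_space ` {C. C \<subseteq> {..<N} \<and> 2 \<le> card C}" "chain\<^sub>\<subseteq> \<sigma>'"
    unfolding W_def[symmetric] \<sigma>'_def[symmetric] by - (elim conjE, assumption)+
  have "finite \<sigma>" "card \<sigma> = Suc j" using IH(1,2) \<sigma> by simp_all
  moreover have "\<forall>U\<in>\<sigma>. U \<subset> coord_space B" unfolding \<sigma>(1) using IH(3) W by (auto dest: psubset_trans)
  moreover have "\<sigma> \<subseteq> coord_space ` {C. C \<subseteq> {..<N} \<and> 2 \<le> card C}"
    unfolding \<sigma>(1) by (intro insert_subsetI W' IH(4))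
  moreover have "chain\<^sub>\<subseteq> \<sigma>"
    unfolding \<sigma>(1) using IH(3,5) by (auto simp: chain_subset_def)
  ultimately show ?case by (intro conjI)
qed

lemma
  assumes "B \<subseteq> {..<N}" "card B = j + 2" "flag_cycle j B \<sigma> \<noteq> 0"
  shows flag_cycle_nonzero_card: "finite \<sigma>" "card \<sigma> = j"
    and flag_cycle_nonzero_psubset: "\<And>U. U \<in> \<sigma> \<Longrightarrow> U \<subset> coord_space B"
    and flag_cycle_nonzero_coord: "\<sigma> \<subseteq> coord_space ` {C. C \<subseteq> {..<N} \<and> 2 \<le> card C}"
    and flag_cycle_nonzero_chain: "chain\<^sub>\<subseteq> \<sigma>"
proof -
  note * = flag_cycle_nonzero_conj[OF assms]
  from * show "finite \<sigma>" "card \<sigma> = j" "\<sigma> \<subseteq> coord_space ` {C. C \<subseteq> {..<N} \<and> 2 \<le> card C}" "chain\<^sub>\<subseteq> \<sigma>"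
    by - (elim conjE, assumption)+
  from * have "\<forall>U\<in>\<sigma>. U \<subset> coord_space B" by (elim conjE)
  then show "\<And>U. U \<in> \<sigma> \<Longrightarrow> U \<subset> coord_space B" by (rule bspec)
qed

text \<open>The factor \<open>coord_space B\<close> carries the induction: the apex leaves the flag
  in the recursive call and reappears as the coordinate space of the smaller index set.\<close>

lemma flag_cycle_tuples:
  assumes "B \<subseteq> {..<N}" "card B = j + 2"
  shows "flag_cycle j B \<sigma> \<in> tuples k (\<Inter>\<sigma> \<inter> coord_space B)"
  using assms
proof (induction j arbitrary: B \<sigma>)
  case 0
  have B: "finite B" "B \<noteq> {}" using 0 by (auto simp: card_gt_0_iff finite_subset)
  have mm: "Max B \<in> B" "Min B \<in> B" using B by auto
  have "Max B \<noteq> Min B"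
  proof
    assume "Max B = Min B"
    then have "x = Min B" if "x \<in> B" for x
      using Max_ge[OF B(1) that] Min_le[OF B(1) that] by simp
    then have "B \<subseteq> {Min B}" by blast
    then show False using 0(2) card_mono[of "{Min B}" B] by simp
  qed
  then have "u (Max B) - u (Min B) \<in> coord_space B"
    using diff_in_coord_space_iff[of "Max B" "Min B" B] mm 0(1) by auto
  then show ?case
    using \<kappa>_coord_space[of B] length_\<kappa> tuples_zero by (auto simp del: tuple_space_simps(1) intro!: tuples_single)
next
  case (Suc j)
  show ?case
    unfolding flag_cycle.simps
  proof (rule tuples_sum)
    fix a assume a: "a \<in> B"
    let ?W = "coord_space (B - {a})"
    show "(if ?W \<in> \<sigma> then signed (rank_in B a) (flag_cycle j (B - {a}) (\<sigma> - {?W})) else 0)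
      \<in> tuples k (\<Inter>\<sigma> \<inter> coord_space B)"
    proof (cases "?W \<in> \<sigma>")
      case True
      have "flag_cycle j (B - {a}) (\<sigma> - {?W}) \<in> tuples k (\<Inter>(\<sigma> - {?W}) \<inter> ?W)"
        using Suc.prems a finite_subset[OF Suc.prems(1)] by (intro Suc.IH) auto
      moreover have "\<Inter>(\<sigma> - {?W}) \<inter> ?W \<subseteq> \<Inter>\<sigma> \<inter> coord_space B"
        using True coord_space_mono[of "B - {a}" B] by blast
      ultimately have "flag_cycle j (B - {a}) (\<sigma> - {?W}) \<in> tuples k (\<Inter>\<sigma> \<inter> coord_space B)"
        using tuples_mono by blast
      then show ?thesis using True tuples_uminus by (simp add: signed_def del: tuple_space_simps(1))
    qed (simp add: tuples_zero)
  qed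
qed

text \<open>An upper bound is enough, because the lower bound for nonzero cycles will force
  equality. Each of the \<open>j + 3\<close> cones has no more flags than its base.\<close>

lemma flag_cycle_supp:
  assumes "finite B" "card B = j + 2"
  shows "finite {\<sigma>. flag_cycle j B \<sigma> \<noteq> 0} \<and> card {\<sigma>. flag_cycle j B \<sigma> \<noteq> 0} \<le> fact (j + 2) div 2"
  using assms
proof (induction j arbitrary: B)
  case 0
  have "{\<sigma>. flag_cycle 0 B \<sigma> \<noteq> 0} \<subseteq> {{}}" by auto
  from finite_subset[OF this] card_mono[OF _ this] show ?case by simp
next
  case (Suc j)
  let ?S = "\<lambda>a. {\<sigma>. flag_cycle j (B - {a}) \<sigma> \<noteq> 0}"
  let ?T = "\<lambda>a. insert (coord_space (B - {a})) ` ?S a"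
  have IH: "finite (?S a) \<and> card (?S a) \<le> fact (j + 2) div 2" if "a \<in> B" for a
    using Suc that by auto
  have sub: "{\<sigma>. flag_cycle (Suc j) B \<sigma> \<noteq> 0} \<subseteq> (\<Union>a\<in>B. ?T a)"
  proof
    fix \<sigma> assume "\<sigma> \<in> {\<sigma>. flag_cycle (Suc j) B \<sigma> \<noteq> 0}"
    then obtain a where a: "a \<in> B" "coord_space (B - {a}) \<in> \<sigma>"
      "flag_cycle j (B - {a}) (\<sigma> - {coord_space (B - {a})}) \<noteq> 0"
      using flag_cycle_SucE by blast
    then have "\<sigma> = insert (coord_space (B - {a})) (\<sigma> - {coord_space (B - {a})})" by blast
    then show "\<sigma> \<in> (\<Union>a\<in>B. ?T a)" using a by blast
  qed
  have fin: "finite (\<Union>a\<in>B. ?T a)" using IH Suc.prems by blast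
  have "card (\<Union>a\<in>B. ?T a) \<le> (\<Sum>a\<in>B. card (?T a))"
    using Suc.prems by (intro card_UN_le)
  also have "\<dots> \<le> (\<Sum>a\<in>B. fact (j + 2) div 2)"
    using IH card_image_le order_trans by (intro sum_mono) blast
  also have "\<dots> = card B * (fact (j + 2) div 2)" by (simp only: sum_constant of_nat_id)
  also have "card B = j + 3" using Suc.prems by simp
  also have "(j + 3) * (fact (j + 2) div 2) = fact (Suc j + 2) div 2" by (rule half_fact_Suc)
  finally show ?case
    using card_mono[OF fin sub] finite_subset[OF sub fin] by linarith
qed

text \<open>Take the flag obtained by deleting indices one at a time. The spaces
  \<open>coord_space (B - {a})\<close> are pairwise incomparable, so at each stage a single summand
  contributes and nothing can cancel.\<close>

lemma flag_cycle_witness: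
  assumes "B \<subseteq> {..<N}" "card B = j + 2"
  shows "\<exists>\<sigma> i b c. b < N \<and> c < N \<and> b \<noteq> c
    \<and> flag_cycle j B \<sigma> = signed i (Poly_Mapping.single (\<kappa> @ [u b - u c]) 1)"
  using assms
proof (induction j arbitrary: B)
  case 0
  then have "card B = 2" by simp
  then obtain b c where bc: "B = {b, c}" "b \<noteq> c" by (auto simp: card_2_iff)
  have "flag_cycle 0 B {} = signed 0 (Poly_Mapping.single (\<kappa> @ [u (max b c) - u (min b c)]) 1)"
    using bc by (simp add: signed_def)
  moreover have "max b c < N" "min b c < N" "max b c \<noteq> min b c"
    using bc 0 by (auto simp: max_def min_def)
  ultimately show ?case by blast
next
  case (Suc j)
  then obtain a where a: "a \<in> B" by fastforce
  have finB: "finite B" using Suc.prems(1) finite_subset by blast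
  have B': "B - {a} \<subseteq> {..<N}" "card (B - {a}) = j + 2"
    using Suc.prems a finB by auto
  let ?W = "coord_space (B - {a})"
  obtain \<sigma> i b c where bc: "b < N" "c < N" "b \<noteq> c"
    and \<sigma>: "flag_cycle j (B - {a}) \<sigma> = signed i (Poly_Mapping.single (\<kappa> @ [u b - u c]) 1)"
    using Suc.IH[OF B'] by blast
  have nz: "flag_cycle j (B - {a}) \<sigma> \<noteq> 0"
    unfolding \<sigma> signed_eq_0_iff by (metis lookup_single_eq lookup_zero zero_neq_one)
  have W: "?W \<notin> \<sigma>" using flag_cycle_nonzero_psubset[OF B' nz, of ?W] by auto
  have other: "coord_space (B - {a'}) \<notin> insert ?W \<sigma>" if a': "a' \<in> B" "a' \<noteq> a" for a'
  proof
    assume "coord_space (B - {a'}) \<in> insert ?W \<sigma>"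
    then have "coord_space (B - {a'}) \<subseteq> ?W"
      using flag_cycle_nonzero_psubset[OF B' nz, of "coord_space (B - {a'})"] by auto
    then show False
      using coord_space_remove_not_subset[OF Suc.prems(1) a a'(1)] a'(2) Suc.prems(2) by simp
  qed
  have "flag_cycle (Suc j) B (insert ?W \<sigma>) = (\<Sum>a'\<in>{a}. signed (rank_in B a) (flag_cycle j (B - {a}) \<sigma>))"
    unfolding flag_cycle.simps using a finB other W
    by (intro sum.mono_neutral_cong_right) auto
  also have "\<dots> = signed (rank_in B a + i) (Poly_Mapping.single (\<kappa> @ [u b - u c]) 1)"
    by (simp add: \<sigma> signed_signed)
  finally show ?case using bc by blast
qed

text \<open>The \<open>\<psi> j\<close> are dual to \<open>\<kappa>\<close>, and
  \<open>\<phi> b\<close> is 1 on \<open>u b - u c\<close> and 0 on \<open>\<kappa>\<close>: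
  together they form a dual system for the tuple.\<close>

lemma flag_cycle_witness_not_ext_rel:
  assumes bc: "b < N" "c < N" "b \<noteq> c" and U: "subspace U"
  shows "signed i (Poly_Mapping.single (\<kappa> @ [u b - u c]) 1) \<notin> ext_rel k U"
proof
  assume "signed i (Poly_Mapping.single (\<kappa> @ [u b - u c]) 1) \<in> ext_rel k U"
  then have "Poly_Mapping.single (\<kappa> @ [u b - u c]) 1 \<in> ext_rel k U"
    using ext_rel_uminus[OF U] by (fastforce simp: signed_def split: if_splits)
  moreover have "Poly_Mapping.single (\<kappa> @ [u b - u c]) 1 \<notin> ext_rel k U"
  proof (rule single_not_ext_rel[where \<phi> = "\<lambda>j. if j < length \<kappa> then \<psi> j else \<phi> b", OF _ U])
    show "Vector_Spaces.linear scale (*) (if j < length \<kappa> then \<psi> j else \<phi> b)" for j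
      using linear_\<phi> linear_\<psi> by simp
    show "(if j < length \<kappa> then \<psi> j else \<phi> b) ((\<kappa> @ [u b - u c]) ! i) = (if i = j then 1 else 0)"
      if "i < length (\<kappa> @ [u b - u c])" "j < length (\<kappa> @ [u b - u c])" for i j
      using that bc by (auto simp: nth_append \<psi>_u \<psi>_\<kappa> \<phi>_u \<phi>_\<kappa> less_Suc_eq)
  qed
  ultimately show False by blast
qed

text \<open>This is the cancellation behind \<open>\<partial>\<partial> = 0\<close> for a simplex on the vertex set \<open>B\<close>.\<close>

lemma flag_cycle_alternating_sum:
  assumes B: "B \<subseteq> {..<N}" "card B = j + 3" and sub: "\<And>t. t \<in> \<tau> \<Longrightarrow> subspace t"
  shows "(\<Sum>a\<in>B. signed (rank_in B a) (flag_cycle j (B - {a}) \<tau>)) \<in> ext_rel k (\<Inter>\<tau> \<inter> coord_space B)"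
proof -
  have finB: "finite B" using B(1) finite_subset by blast
  have S: "subspace (\<Inter>\<tau> \<inter> coord_space B)"
    using sub by (intro subspace_inter subspace_Inter subspace_coord_space) auto
  show ?thesis
  proof (cases j)
    \<comment> \<open>Only this case uses a relation: the three differences cancel in the exterior
      power but not as formal sums. For larger \<open>j\<close> the sum is identically 0.\<close>
    case 0
    show ?thesis
    proof (cases "\<tau> = {}")
      case True
      obtain x y z where xyz: "B = {x, y, z}" "x < y" "y < z"
      proof -
        define l where "l = sorted_list_of_set B"
        have l: "set l = B" "sorted_wrt (<) l" "length l = 3"
          using finB B(2) 0 by (simp_all add: l_def)
        then obtain x y z where "l = [x, y, z]" by (auto simp: numeral_3_eq_3 length_Suc_conv)
        then show ?thesis using that l by auto
      qed
      have rem: "B - {x} = {y, z}" "B - {y} = {x, z}" "B - {z} = {x, y}" using xyz by auto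
      have "{b \<in> B. b < x} = {}" "{b \<in> B. b < y} = {x}" "{b \<in> B. b < z} = {x, y}" using xyz by auto
      then have rank: "rank_in B x = 0" "rank_in B y = 1" "rank_in B z = 2"
        using xyz by (simp_all add: rank_in_def)
      let ?s = "\<lambda>v. Poly_Mapping.single (\<kappa> @ [v]) (1::'a)"
      have "(\<Sum>a\<in>B. signed (rank_in B a) (flag_cycle j (B - {a}) \<tau>))
          = ?s (u z - u y) - ?s (u z - u x) + ?s (u y - u x)"
      proof -
        have "(\<Sum>a\<in>B. signed (rank_in B a) (flag_cycle j (B - {a}) \<tau>))
          = (\<Sum>a\<in>{x, y, z}. signed (rank_in B a) (flag_cycle j (B - {a}) \<tau>))" using xyz by simp
        also have "\<dots> = ?s (u z - u y) - ?s (u z - u x) + ?s (u y - u x)"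
          using xyz(2,3) by (simp add: rem rank 0 True signed_def)
        finally show ?thesis .
      qed
      moreover have "?s (u z - u x) - ?s (u z - u y) - ?s (u y - u x) \<in> ext_rel k (coord_space B)"
      proof -
        have "u z - u y \<in> coord_space B" "u y - u x \<in> coord_space B"
          using xyz B(1) diff_in_coord_space_iff by auto
        from ext_rel_multilinear[of \<kappa> "[]" k "coord_space B", OF _ _ _ this, of 1 1 1]
        show ?thesis using length_\<kappa> \<kappa>_coord_space by simp
      qed
      then have "- (?s (u z - u x) - ?s (u z - u y) - ?s (u y - u x)) \<in> ext_rel k (coord_space B)"
        by (intro ext_rel_uminus subspace_coord_space)
      moreover have "- (?s (u z - u x) - ?s (u z - u y) - ?s (u y - u x))
          = ?s (u z - u y) - ?s (u z - u x) + ?s (u y - u x)" by simp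
      ultimately show ?thesis using True by (simp only: Inf_empty inf_top_left)
    qed (simp add: 0 ext_rel_zero[OF S])
  next
    case (Suc i)
    let ?W = "\<lambda>a a'. coord_space (B - {a} - {a'})"
    have "(\<Sum>a\<in>B. signed (rank_in B a) (flag_cycle j (B - {a}) \<tau>))
      = (\<Sum>a\<in>B. \<Sum>a'\<in>B - {a}. if ?W a a' \<in> \<tau>
          then signed (rank_in B a + rank_in (B - {a}) a') (flag_cycle i (B - {a} - {a'}) (\<tau> - {?W a a'})) else 0)"
      unfolding Suc flag_cycle.simps signed_sum
      by (intro sum.cong refl) (auto simp: signed_signed)
    also have "\<dots> = 0"
    proof (rule sum_antisymmetric_eq_0[OF finB])
      fix a a' assume a: "a \<in> B" "a' \<in> B" "a < a'"
      have sw: "B - {a'} - {a} = B - {a} - {a'}" by blast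
      have "rank_in B a' + rank_in (B - {a'}) a = Suc (rank_in B a + rank_in (B - {a}) a')"
        using rank_in_remove[OF finB a(1,3)] by simp
      then show "(if ?W a' a \<in> \<tau>
          then signed (rank_in B a' + rank_in (B - {a'}) a) (flag_cycle i (B - {a'} - {a}) (\<tau> - {?W a' a})) else 0)
        = - (if ?W a a' \<in> \<tau>
          then signed (rank_in B a + rank_in (B - {a}) a') (flag_cycle i (B - {a} - {a'}) (\<tau> - {?W a a'})) else 0)"
        by (simp add: sw signed_def)
    qed
    finally show ?thesis by (simp add: ext_rel_zero[OF S])
  qed
qed

text \<open>Boundary of a cone: faces that contain the apex give the cone over the boundary of the
  base, a relation by induction; the face opposite the apex gives the base back. The bases then
  cancel by \<open>flag_cycle_alternating_sum\<close>. A general \<open>\<Omega>\<close> keeps the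
  flag complex out of the induction.\<close>

lemma flag_cycle_boundary:
  assumes "finite \<Omega>" "\<And>C. coord_space C \<in> \<Omega>"
    and "B \<subseteq> {..<N}" "card B = j + 2" "finite \<tau>" "\<And>t. t \<in> \<tau> \<Longrightarrow> subspace t"
  shows "(\<Sum>U\<in>\<Omega> - \<tau>. signed (card {t \<in> \<tau>. t \<subset> U}) (flag_cycle j B (insert U \<tau>)))
    \<in> ext_rel k (\<Inter>\<tau> \<inter> coord_space B)"
  using assms(3-6)
proof (induction j arbitrary: B \<tau>)
  case (0 B \<tau>)
  have "subspace (\<Inter>\<tau> \<inter> coord_space B)"
    using 0 by (intro subspace_inter subspace_Inter subspace_coord_space) auto
  then show ?case by (simp add: ext_rel_zero)
next
  case (Suc j B \<tau>)
  have finB: "finite B" using Suc.prems(1) finite_subset by blast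
  have S: "subspace (\<Inter>\<tau> \<inter> coord_space B)"
    using Suc.prems by (intro subspace_inter subspace_Inter subspace_coord_space) auto
  let ?W = "\<lambda>a. coord_space (B - {a})"
  \<comment> \<open>The contribution to the face \<open>\<tau>\<close> of the cone with apex
    \<open>?W a\<close>, with the sign of \<open>a\<close> left out.\<close>
  define X where "X a U = (if ?W a \<in> insert U \<tau>
      then signed (card {t \<in> \<tau>. t \<subset> U}) (flag_cycle j (B - {a}) (insert U \<tau> - {?W a})) else 0)" for a U
  have B': "B - {a} \<subseteq> {..<N}" "card (B - {a}) = j + 2" if "a \<in> B" for a
    using Suc.prems that finB by auto
  have X: "(\<Sum>U\<in>\<Omega> - \<tau>. X a U) - signed (card \<tau>) (flag_cycle j (B - {a}) \<tau>) \<in> ext_rel k (\<Inter>\<tau> \<inter> coord_space B)"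
    if a: "a \<in> B" for a
  proof (cases "?W a \<in> \<tau>")
    \<comment> \<open>The apex lies in the face. Every contributing \<open>U\<close> is properly
      below it, so dropping the apex from \<open>\<tau>\<close> leaves the sign of \<open>U\<close>
      unchanged and the induction hypothesis applies to the base.\<close>
    case True
    define \<tau>' where "\<tau>' = \<tau> - {?W a}"
    have \<tau>: "\<tau> = insert (?W a) \<tau>'" using True by (auto simp: \<tau>'_def)
    have below: "U \<subset> ?W a" if "flag_cycle j (B - {a}) \<sigma> \<noteq> 0" "U \<in> \<sigma>" for U \<sigma>
      using flag_cycle_nonzero_psubset[OF B'[OF a] that(1,2)] .
    have "flag_cycle j (B - {a}) \<tau> = 0" using below[of \<tau> "?W a"] True by blast
    moreover have "(\<Sum>U\<in>\<Omega> - \<tau>. X a U)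
        = (\<Sum>U\<in>\<Omega> - \<tau>'. signed (card {t \<in> \<tau>'. t \<subset> U}) (flag_cycle j (B - {a}) (insert U \<tau>')))"
    proof (rule sum.mono_neutral_cong_left)
      show "finite (\<Omega> - \<tau>')" using assms(1) by simp
      show "\<Omega> - \<tau> \<subseteq> \<Omega> - \<tau>'" by (auto simp: \<tau>'_def)
      show "\<forall>U\<in>\<Omega> - \<tau>' - (\<Omega> - \<tau>). signed (card {t \<in> \<tau>'. t \<subset> U}) (flag_cycle j (B - {a}) (insert U \<tau>')) = 0"
        using below[of "insert (?W a) \<tau>'" "?W a"] by (auto simp: \<tau>)
      fix U assume U: "U \<in> \<Omega> - \<tau>"
      then have *: "insert U \<tau> - {?W a} = insert U \<tau>'" using \<tau>'_def True by blast
      show "X a U = signed (card {t \<in> \<tau>'. t \<subset> U}) (flag_cycle j (B - {a}) (insert U \<tau>'))"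
      proof (cases "flag_cycle j (B - {a}) (insert U \<tau>') = 0")
        case False
        then have "{t \<in> \<tau>. t \<subset> U} = {t \<in> \<tau>'. t \<subset> U}" using below[of "insert U \<tau>'" U] by (auto simp: \<tau>)
        then show ?thesis using True * by (simp add: X_def)
      qed (use True * in \<open>simp add: X_def\<close>)
    qed
    moreover have "\<dots> \<in> ext_rel k (\<Inter>\<tau>' \<inter> ?W a)"
      using Suc.prems by (intro Suc.IH B' a) (auto simp: \<tau>'_def)
    moreover have "\<Inter>\<tau>' \<inter> ?W a = \<Inter>\<tau> \<inter> coord_space B"
      using coord_space_mono[of "B - {a}" B] by (auto simp: \<tau>)
    ultimately show ?thesis by simp
  next
    \<comment> \<open>The apex is missing from the face, so only \<open>U = ?W a\<close>
      contributes; as the largest vertex it has all of \<open>\<tau>\<close> below it, hence the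
      sign \<open>card \<tau>\<close>.\<close>
    case False
    have "(\<Sum>U\<in>\<Omega> - \<tau>. X a U) = (\<Sum>U\<in>{?W a}. X a U)"
      using assms(1,2) False by (intro sum.mono_neutral_right) (auto simp: X_def)
    also have "\<dots> = signed (card {t \<in> \<tau>. t \<subset> ?W a}) (flag_cycle j (B - {a}) \<tau>)"
      using False by (simp add: X_def)
    also have "\<dots> = signed (card \<tau>) (flag_cycle j (B - {a}) \<tau>)"
    proof (cases "flag_cycle j (B - {a}) \<tau> = 0")
      case False
      then have "{t \<in> \<tau>. t \<subset> ?W a} = \<tau>"
        using flag_cycle_nonzero_psubset[OF B'[OF a] False] by auto
      then show ?thesis by simp
    qed simp
    finally show ?thesis by (simp add: ext_rel_zero[OF S])
  qed
  have ext_rel_signed: "signed i f \<in> ext_rel k (\<Inter>\<tau> \<inter> coord_space B)"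
    if "f \<in> ext_rel k (\<Inter>\<tau> \<inter> coord_space B)" for i f
    using that ext_rel_uminus[OF S] by (simp add: signed_def)
  have "(\<Sum>U\<in>\<Omega> - \<tau>. signed (card {t \<in> \<tau>. t \<subset> U}) (flag_cycle (Suc j) B (insert U \<tau>)))
      = (\<Sum>U\<in>\<Omega> - \<tau>. \<Sum>a\<in>B. signed (rank_in B a) (X a U))"
    unfolding flag_cycle.simps signed_sum
    by (intro sum.cong refl) (auto simp: X_def signed_signed add.commute)
  also have "\<dots> = (\<Sum>a\<in>B. signed (rank_in B a) (\<Sum>U\<in>\<Omega> - \<tau>. X a U))"
    unfolding signed_sum by (rule sum.swap)
  also have "\<dots> = (\<Sum>a\<in>B. signed (rank_in B a)
        ((\<Sum>U\<in>\<Omega> - \<tau>. X a U) - signed (card \<tau>) (flag_cycle j (B - {a}) \<tau>)))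
      + signed (card \<tau>) (\<Sum>a\<in>B. signed (rank_in B a) (flag_cycle j (B - {a}) \<tau>))"
    unfolding signed_sum sum.distrib[symmetric] by (intro sum.cong) (auto simp: signed_def sum_negf)
  also have "\<dots> \<in> ext_rel k (\<Inter>\<tau> \<inter> coord_space B)"
    using Suc.prems by (intro ext_rel_add S ext_rel_sum ext_rel_signed X flag_cycle_alternating_sum) auto
  finally show ?case .
qed

end

section \<open>Existence of the coordinate model\<close>

context exterior_space
begin

text \<open>The first \<open>m + 1\<close> basis vectors span a copy of the sum-zero hyperplane in
  \<open>m + 2\<close> coordinates, with \<open>e b\<close> in the role of a difference with the
  last coordinate vector; the remaining \<open>k - 1\<close> basis vectors form
  \<open>\<kappa>\<close>.\<close>

lemma exists_general_position:
  assumes "card Basis = k + m" "1 \<le> k"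
  shows "\<exists>\<phi> \<psi> u \<kappa>. general_position scale Basis (m + 2) k \<phi> \<psi> u \<kappa>"
proof -
  obtain e where e: "bij_betw e {0..<k + m} Basis"
    using ex_bij_betw_nat_finite[OF finite_Basis] assms(1) by auto
  define R where "R i x = representation Basis x (e i)" for i x
  have lin: "Vector_Spaces.linear scale (*) (R i)" for i
    unfolding R_def by (rule linear_representation[OF independent_Basis span_Basis])
  have R_add: "R i (x + y) = R i x + R i y" and R_scale: "R i (scale c x) = c * R i x" for i x y c
    using lin[of i] by (simp_all add: Vector_Spaces.linear_iff)
  have R_e: "R i (e j) = (if i = j then 1 else 0)" if "i < k + m" "j < k + m" for i j
  proof -
    have "e i = e j \<longleftrightarrow> i = j" using e that by (auto simp: bij_betw_def inj_on_eq_iff)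
    moreover have "e j \<in> Basis" using e that by (auto simp: bij_betw_def)
    ultimately show ?thesis by (simp add: R_def representation_basis[OF independent_Basis])
  qed
  have R_0: "R i 0 = 0" for i using R_scale[of i 0 0] by simp
  have R_diff: "R i (x - y) = R i x - R i y" for i x y
    using R_add[of i "x - y" y] by simp
  \<comment> \<open>The last vector \<open>u (m + 1)\<close> is 0, and the last functional is minus
    the sum of the others, as the sum-zero condition dictates.\<close>
  define u where "u b = (if b \<le> m then e b else 0)" for b
  define \<kappa> where "\<kappa> = map e [m + 1..<k + m]"
  define \<phi> where "\<phi> a = (if a \<le> m then R a else (\<lambda>x. - (\<Sum>i\<le>m. R i x)))" for a
  have R_u: "R i (u b) = (if i = b \<and> b \<le> m then 1 else 0)" if "i < k + m" for i b
    using that assms(2) by (auto simp: u_def R_e R_0)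
  have "general_position scale Basis (m + 2) k \<phi> (\<lambda>j. R (m + 1 + j)) u \<kappa>"
  proof (intro general_position.intro exterior_space_axioms general_position_axioms.intro)
    show "length \<kappa> + 1 = k" using assms(2) by (simp add: \<kappa>_def)
    show "Vector_Spaces.linear scale (*) (\<phi> a)" for a
    proof (cases "a \<le> m")
      case False
      have "vector_space ((*) :: 'a \<Rightarrow> 'a \<Rightarrow> 'a)" by unfold_locales (auto simp: algebra_simps)
      then show ?thesis
        using False vector_space_axioms
        by (auto simp: \<phi>_def Vector_Spaces.linear_iff R_add R_scale sum.distrib sum_distrib_left sum_negf)
    qed (use lin in \<open>simp add: \<phi>_def\<close>)
    show "Vector_Spaces.linear scale (*) (R (m + 1 + j))" for j by (rule lin)
    show "\<phi> a (u b - u c) = (if a = b then 1 else 0) - (if a = c then 1 else 0)"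
      if "a < m + 2" "b < m + 2" "c < m + 2" for a b c
    proof (cases "a \<le> m")
      case True
      then show ?thesis using assms(2) by (auto simp: \<phi>_def R_diff R_u)
    next
      case False
      have "(\<Sum>i\<le>m. R i (u d)) = (if d \<le> m then 1 else 0)" for d
      proof -
        have "(\<Sum>i\<le>m. R i (u d)) = (\<Sum>i\<le>m. if d = i then (if d \<le> m then 1 else 0) else 0)"
          using assms(2) by (intro sum.cong) (auto simp: R_u)
        then show ?thesis by simp
      qed
      then show ?thesis using False that by (auto simp: \<phi>_def R_diff sum_subtractf)
    qed
    show "\<phi> a x = 0" if "a < m + 2" and x: "x \<in> set \<kappa>" for a x
    proof -
      obtain j where "x = e j" "m < j" "j < k + m" using x by (auto simp: \<kappa>_def)
      then have "R i x = 0" if "i \<le> m" for i using that by (simp add: R_e)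
      then show ?thesis by (simp add: \<phi>_def)
    qed
    show "R (m + 1 + j) (u b - u c) = 0" if "j < length \<kappa>" "b < m + 2" "c < m + 2" for j b c
      using that by (auto simp: R_diff R_u \<kappa>_def)
    show "R (m + 1 + j) (\<kappa> ! i) = (if i = j then 1 else 0)" if "i < length \<kappa>" "j < length \<kappa>" for i j
      using that by (auto simp: \<kappa>_def R_e)
  qed
  then show ?thesis by blast
qed

end

section \<open>Chains of flags and their representatives\<close>

context exterior_space
begin

section \<open>Cosets and their representatives\<close>

abbreviation ext_class :: "nat \<Rightarrow> 'b set \<Rightarrow> ('b list \<Rightarrow>\<^sub>0 'a) \<Rightarrow> ('b list \<Rightarrow>\<^sub>0 'a) set" where
  "ext_class k U f \<equiv> ext_rel k U #>\<^bsub>tuple_space k U\<^esub> f"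

lemma normal_ext_rel: "subspace U \<Longrightarrow> normal (ext_rel k U) (tuple_space k U)"
  using comm_group.normal_iff_subgroup[OF comm_group_tuple_space]
    subgroup_exterior_relations[OF vector_space_axioms] by blast

lemma ext_class_carrier:
  "f \<in> tuples k U \<Longrightarrow> ext_class k U f \<in> carrier (exterior_power scale k U)"
  by (auto simp: exterior_power_def carrier_FactGroup simp del: tuple_space_simps(1))

lemma exterior_power_carrierE:
  assumes "x \<in> carrier (exterior_power scale k U)"
  obtains f where "f \<in> tuples k U" "x = ext_class k U f"
  using assms by (auto simp: exterior_power_def carrier_FactGroup simp del: tuple_space_simps(1))

lemma one_exterior_power: "\<one>\<^bsub>exterior_power scale k U\<^esub> = ext_rel k U"
  by (simp add: exterior_power_def)

lemma ext_class_eq_one_iff: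
  assumes "subspace U" "f \<in> tuples k U"
  shows "ext_class k U f = \<one>\<^bsub>exterior_power scale k U\<^esub> \<longleftrightarrow> f \<in> ext_rel k U"
proof -
  interpret comm_group "tuple_space k U :: ('b list \<Rightarrow>\<^sub>0 'a) monoid" by (rule comm_group_tuple_space)
  have sg: "subgroup (ext_rel k U) (tuple_space k U)"
    by (rule subgroup_exterior_relations[OF vector_space_axioms assms(1)])
  show ?thesis
    unfolding one_exterior_power
    using coset_join1[OF _ assms(2) sg] coset_join2[OF assms(2) sg] by blast
qed

lemma ext_class_add:
  assumes "subspace U" "f \<in> tuples k U" "g \<in> tuples k U"
  shows "ext_class k U f \<otimes>\<^bsub>exterior_power scale k U\<^esub> ext_class k U g = ext_class k U (f + g)"
  using normal.rcos_sum[OF normal_ext_rel[OF assms(1)] assms(2,3)]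
  by (simp add: exterior_power_def del: tuple_space_simps(1))

lemma ext_class_signed:
  assumes "subspace U" "f \<in> tuples k U"
  shows "ext_class k U f [^]\<^bsub>exterior_power scale k U\<^esub> ((-1) ^ i :: int) = ext_class k U (signed i f)"
proof -
  interpret P: comm_group "exterior_power scale k U"
    by (rule comm_group_exterior_power[OF vector_space_axioms assms(1)])
  have c: "ext_class k U f \<in> carrier (exterior_power scale k U)"
    "ext_class k U (- f) \<in> carrier (exterior_power scale k U)"
    using assms(2) tuples_uminus by (blast intro: ext_class_carrier)+
  have "ext_class k U (- f) \<otimes>\<^bsub>exterior_power scale k U\<^esub> ext_class k U f = \<one>\<^bsub>exterior_power scale k U\<^esub>"
    using ext_class_add[OF assms(1) tuples_uminus[OF assms(2)] assms(2)]
      ext_class_eq_one_iff[OF assms(1) tuples_zero] ext_rel_zero[OF assms(1)] by simp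
  then have "inv\<^bsub>exterior_power scale k U\<^esub> ext_class k U f = ext_class k U (- f)"
    using c by (intro P.inv_equality)
  moreover have "ext_class k U f [^]\<^bsub>exterior_power scale k U\<^esub> (1::int) = ext_class k U f"
    using c(1) by (rule P.int_pow_1)
  moreover have "ext_class k U f [^]\<^bsub>exterior_power scale k U\<^esub> (- 1::int)
      = inv\<^bsub>exterior_power scale k U\<^esub> (ext_class k U f [^]\<^bsub>exterior_power scale k U\<^esub> (1::int))"
    using P.int_pow_neg[OF c(1), of 1] .
  ultimately show ?thesis by (cases "even i") (simp_all add: signed_def)
qed

lemma tuples_signed: "f \<in> tuples k U \<Longrightarrow> signed i f \<in> tuples k U"
  using tuples_uminus by (simp add: signed_def del: tuple_space_simps(1))

lemma ext_rel_signed_iff: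
  "subspace U \<Longrightarrow> signed i f \<in> ext_rel k U \<longleftrightarrow> f \<in> ext_rel k U"
  using ext_rel_uminus[of U f k] ext_rel_uminus[of U "- f" k] by (auto simp: signed_def)

lemma finprod_ext_class:
  assumes U: "subspace U" and I: "finite I" and f: "\<And>i. i \<in> I \<Longrightarrow> f i \<in> tuples k U"
  shows "finprod (exterior_power scale k U)
      (\<lambda>i. ext_class k U (f i) [^]\<^bsub>exterior_power scale k U\<^esub> ((-1) ^ s i :: int)) I
    = ext_class k U (\<Sum>i\<in>I. signed (s i) (f i))"
proof -
  interpret P: comm_group "exterior_power scale k U"
    by (rule comm_group_exterior_power[OF vector_space_axioms U])
  have "finprod (exterior_power scale k U) (\<lambda>i. ext_class k U (signed (s i) (f i))) I
      = ext_class k U (\<Sum>i\<in>I. signed (s i) (f i))"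
    using I f
  proof (induction I)
    case empty
    then show ?case
      using ext_class_eq_one_iff[OF U tuples_zero] ext_rel_zero[OF U] by simp
  next
    case (insert j I)
    have mem: "signed (s i) (f i) \<in> tuples k U" if "i \<in> insert j I" for i
      using insert.prems[OF that] by (rule tuples_signed)
    have "finprod (exterior_power scale k U) (\<lambda>i. ext_class k U (signed (s i) (f i))) (insert j I)
      = ext_class k U (signed (s j) (f j)) \<otimes>\<^bsub>exterior_power scale k U\<^esub>
        finprod (exterior_power scale k U) (\<lambda>i. ext_class k U (signed (s i) (f i))) I"
      using insert.hyps mem by (intro P.finprod_insert) (auto intro!: ext_class_carrier simp del: tuple_space_simps(1))
    also have "\<dots> = ext_class k U (signed (s j) (f j) + (\<Sum>i\<in>I. signed (s i) (f i)))"
      using insert.IH insert.prems mem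
      by (simp add: ext_class_add[OF U] tuples_sum del: tuple_space_simps(1))
    finally show ?case using insert.hyps by simp
  qed
  moreover have "finprod (exterior_power scale k U)
      (\<lambda>i. ext_class k U (f i) [^]\<^bsub>exterior_power scale k U\<^esub> ((-1) ^ s i :: int)) I
    = finprod (exterior_power scale k U) (\<lambda>i. ext_class k U (signed (s i) (f i))) I"
    using f by (intro P.finprod_cong) (auto intro!: ext_class_carrier tuples_signed simp: ext_class_signed[OF U] simp_implies_def simp del: tuple_space_simps(1))
  ultimately show ?thesis by simp
qed

section \<open>The boundary operator on representatives\<close>

abbreviation flags :: "int \<Rightarrow> 'b set set set" where
  "flags p \<equiv> simplices (flag_complex scale) p"

lemma flag_complexD:
  assumes "\<sigma> \<in> flag_complex scale"
  shows "finite \<sigma>" "U \<in> \<sigma> \<Longrightarrow> subspace U" "U \<in> \<sigma> \<Longrightarrow> U \<in> proper_subspaces scale" "chain\<^sub>\<subseteq> \<sigma>" "subspace (\<Inter>\<sigma>)"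
proof -
  show "finite \<sigma>" "U \<in> \<sigma> \<Longrightarrow> subspace U" "U \<in> \<sigma> \<Longrightarrow> U \<in> proper_subspaces scale" "chain\<^sub>\<subseteq> \<sigma>"
    using assms by (auto simp: flag_complex_def proper_subspaces_def chain_subset_def)
  show "subspace (\<Inter>\<sigma>)"
    using assms by (intro subspace_Inter) (auto simp: flag_complex_def proper_subspaces_def)
qed

lemma flag_complex_subset: "\<sigma> \<in> flag_complex scale \<Longrightarrow> \<tau> \<subseteq> \<sigma> \<Longrightarrow> \<tau> \<in> flag_complex scale"
  using simplicial_complex_flag_complex[of scale] unfolding simplicial_complex_def by blast

definition dim_order :: "'b set rel \<Rightarrow> bool" where
  "dim_order r \<longleftrightarrow> linear_order_on (proper_subspaces scale) r \<and>
     (\<forall>U\<in>proper_subspaces scale. \<forall>W\<in>proper_subspaces scale. dim U < dim W \<longrightarrow> (U, W) \<in> r)"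

text \<open>On a flag the vertex order is strict inclusion, so boundary signs depend only on the
  flag and not on the choice of \<open>r\<close>.\<close>

lemma dim_order_flag:
  assumes r: "dim_order r" and \<sigma>: "\<sigma> \<in> flag_complex scale" and mem: "t \<in> \<sigma>" "U \<in> \<sigma>"
  shows "t \<noteq> U \<and> (t, U) \<in> r \<longleftrightarrow> t \<subset> U"
proof -
  have less: "(A, B) \<in> r" if "A \<in> \<sigma>" "B \<in> \<sigma>" "A \<subset> B" for A B
  proof -
    have "span A = A" "span B = B" using flag_complexD(2)[OF \<sigma>] that by (simp_all add: span_eq_iff)
    then have "dim A < dim B" using dim_psubset[of A B] that(3) by (simp only:)
    then show ?thesis using r that flag_complexD(3)[OF \<sigma>] by (auto simp: dim_order_def)
  qed
  have anti: "antisym r" using r by (auto simp: dim_order_def order_on_defs)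
  have "t \<subseteq> U \<or> U \<subseteq> t" using flag_complexD(4)[OF \<sigma>] mem by (auto simp: chain_subset_def)
  then consider "t = U" | "t \<subset> U" | "U \<subset> t" by (auto simp: psubset_eq)
  then show ?thesis
  proof cases
    case 3
    then have "(t, U) \<notin> r" using less[OF mem(2,1)] anti by (auto dest: antisymD)
    then show ?thesis using 3 by auto
  qed (use less[OF mem] in auto)
qed

definition coface_verts :: "'b set set \<Rightarrow> 'b set set" where
  "coface_verts \<tau> = {U. U \<notin> \<tau> \<and> insert U \<tau> \<in> flag_complex scale}"

definition rep_boundary :: "('b set set \<Rightarrow> ('b list \<Rightarrow>\<^sub>0 'a)) \<Rightarrow> 'b set set \<Rightarrow> ('b list \<Rightarrow>\<^sub>0 'a)" where
  "rep_boundary F \<tau> = (\<Sum>U\<in>coface_verts \<tau>. signed (card {t \<in> \<tau>. t \<subset> U}) (F (insert U \<tau>)))"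

lemma flags_insert:
  assumes "\<tau> \<in> flags (p - 1)" "U \<in> coface_verts \<tau>"
  shows "insert U \<tau> \<in> flags p"
  using assms flag_complexD(1)[of \<tau>] by (auto simp: simplices_def coface_verts_def)

lemma flags_remove:
  assumes "\<sigma> \<in> flags p" "U \<in> \<sigma>"
  shows "\<sigma> - {U} \<in> flags (p - 1)" "U \<in> coface_verts (\<sigma> - {U})"
proof -
  have \<sigma>: "\<sigma> \<in> flag_complex scale" "int (card \<sigma>) = p + 1" using assms(1) by (auto simp: simplices_def)
  have "card \<sigma> = Suc (card (\<sigma> - {U}))"
    using flag_complexD(1)[OF \<sigma>(1)] assms(2) by (rule card.remove)
  then show "\<sigma> - {U} \<in> flags (p - 1)"
    using \<sigma> flag_complex_subset[OF \<sigma>(1), of "\<sigma> - {U}"] by (auto simp: simplices_def)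
  show "U \<in> coface_verts (\<sigma> - {U})"
    using \<sigma> assms(2) by (auto simp: coface_verts_def insert_absorb)
qed

text \<open>The pairs of a coface and a deleted vertex are parametrised by the vertex alone, and the
  connecting map keeps the representative; the multiplicative product thus becomes the class of a
  signed sum.\<close>

lemma boundary_ext_class:
  assumes fin: "finite (UNIV :: 'b set)" and r: "dim_order r" and \<tau>: "\<tau> \<in> flags (p - 1)"
    and F: "\<And>\<sigma>. \<sigma> \<in> flags p \<Longrightarrow> F \<sigma> \<in> tuples k (\<Inter>\<sigma>)"
    and c: "\<And>\<sigma>. \<sigma> \<in> flags p \<Longrightarrow> c \<sigma> = ext_class k (\<Inter>\<sigma>) (F \<sigma>)"
  shows "boundary (flag_complex scale) r (ext_stalk scale k) (ext_connecting scale k) p c \<tau>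
    = ext_class k (\<Inter>\<tau>) (rep_boundary F \<tau>)"
proof -
  let ?P = "exterior_power scale k (\<Inter>\<tau>)" and ?I = "coface_verts \<tau>"
  let ?g = "\<lambda>U. (insert U \<tau>, U)"
  have \<tau>X: "\<tau> \<in> flag_complex scale" using \<tau> by (simp add: simplices_def)
  have S: "subspace (\<Inter>\<tau>)" by (rule flag_complexD(5)[OF \<tau>X])
  interpret P: comm_group ?P
    by (rule comm_group_exterior_power[OF vector_space_axioms S])
  have finI: "finite ?I" using fin by (simp add: Finite_Set.finite_set finite_subset[OF subset_UNIV])
  have Ft: "F (insert U \<tau>) \<in> tuples k (\<Inter>\<tau>)" if "U \<in> ?I" for U
    using F[OF flags_insert[OF \<tau> that]] by (rule tuples_mono[rotated]) auto
  have idx: "{(\<sigma>, s). \<sigma> \<in> flags p \<and> s \<in> \<sigma> \<and> \<sigma> - {s} = \<tau>} = ?g ` ?I"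
  proof (intro subset_antisym subsetI)
    fix x assume "x \<in> {(\<sigma>, s). \<sigma> \<in> flags p \<and> s \<in> \<sigma> \<and> \<sigma> - {s} = \<tau>}"
    then obtain \<sigma> s where x: "x = (\<sigma>, s)" "\<sigma> \<in> flags p" "s \<in> \<sigma>" "\<sigma> - {s} = \<tau>" by auto
    then have "x = ?g s" by auto
    moreover have "s \<in> ?I" using flags_remove(2)[OF x(2,3)] x(4) by simp
    ultimately show "x \<in> ?g ` ?I" by (rule image_eqI)
  next
    fix x assume "x \<in> ?g ` ?I"
    then obtain U where U: "x = (insert U \<tau>, U)" "U \<in> ?I" by auto
    then show "x \<in> {(\<sigma>, s). \<sigma> \<in> flags p \<and> s \<in> \<sigma> \<and> \<sigma> - {s} = \<tau>}"
      using flags_insert[OF \<tau> U(2)] by (auto simp: coface_verts_def)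
  qed
  have inj: "inj_on ?g ?I" by (auto simp: inj_on_def)
  have val: "ext_connecting scale k \<tau> (insert U \<tau>) (c (insert U \<tau>))
      [^]\<^bsub>?P\<^esub> ((-1) ^ card {t \<in> insert U \<tau>. t \<noteq> U \<and> (t, U) \<in> r} :: int)
    = ext_class k (\<Inter>\<tau>) (F (insert U \<tau>)) [^]\<^bsub>?P\<^esub> ((-1) ^ card {t \<in> \<tau>. t \<subset> U} :: int)"
    if U: "U \<in> ?I" for U
  proof -
    have X: "insert U \<tau> \<in> flag_complex scale" using U by (simp add: coface_verts_def)
    have "{t \<in> insert U \<tau>. t \<noteq> U \<and> (t, U) \<in> r} = {t \<in> insert U \<tau>. t \<subset> U}"
      using dim_order_flag[OF r X _ insertI1] by blast
    also have "\<dots> = {t \<in> \<tau>. t \<subset> U}" by auto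
    finally have 1: "{t \<in> insert U \<tau>. t \<noteq> U \<and> (t, U) \<in> r} = {t \<in> \<tau>. t \<subset> U}" .
    have "\<Inter>(insert U \<tau>) \<subseteq> \<Inter>\<tau>" by auto
    then have "exterior_incl scale k (\<Inter>\<tau>) (ext_class k (\<Inter>(insert U \<tau>)) (F (insert U \<tau>)))
      = ext_class k (\<Inter>\<tau>) (F (insert U \<tau>))"
      by (intro exterior_incl_coset vector_space_axioms flag_complexD(5)[OF X] S)
    then show ?thesis
      unfolding 1 ext_connecting_def c[OF flags_insert[OF \<tau> U]] by (simp only:)
  qed
  have cl: "ext_class k (\<Inter>\<tau>) (F (insert U \<tau>)) [^]\<^bsub>?P\<^esub> (e :: int) \<in> carrier ?P" if "U \<in> ?I" for U e
    by (intro P.int_pow_closed ext_class_carrier Ft that)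
  have "boundary (flag_complex scale) r (ext_stalk scale k) (ext_connecting scale k) p c \<tau>
    = finprod ?P (\<lambda>(\<sigma>, s). ext_connecting scale k \<tau> \<sigma> (c \<sigma>)
        [^]\<^bsub>?P\<^esub> ((-1) ^ card {t \<in> \<sigma>. t \<noteq> s \<and> (t, s) \<in> r} :: int)) (?g ` ?I)"
    using \<tau> by (simp add: boundary_def ext_stalk_def idx)
  also have "\<dots> = finprod ?P (\<lambda>U. ext_connecting scale k \<tau> (insert U \<tau>) (c (insert U \<tau>))
        [^]\<^bsub>?P\<^esub> ((-1) ^ card {t \<in> insert U \<tau>. t \<noteq> U \<and> (t, U) \<in> r} :: int)) ?I"
    using inj val cl by (subst P.finprod_reindex) auto
  also have "\<dots> = finprod ?P (\<lambda>U. ext_class k (\<Inter>\<tau>) (F (insert U \<tau>))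
        [^]\<^bsub>?P\<^esub> ((-1) ^ card {t \<in> \<tau>. t \<subset> U} :: int)) ?I"
    using val cl by (intro P.finprod_cong) (auto simp: simp_implies_def)
  also have "\<dots> = ext_class k (\<Inter>\<tau>) (rep_boundary F \<tau>)"
    unfolding rep_boundary_def by (rule finprod_ext_class[OF S finI Ft])
  finally show ?thesis .
qed

lemma rep_boundary_tuples:
  assumes "\<tau> \<in> flags (p - 1)" "\<And>\<sigma>. \<sigma> \<in> flags p \<Longrightarrow> F \<sigma> \<in> tuples k (\<Inter>\<sigma>)"
  shows "rep_boundary F \<tau> \<in> tuples k (\<Inter>\<tau>)"
  unfolding rep_boundary_def
proof (intro tuples_sum tuples_signed)
  fix U assume "U \<in> coface_verts \<tau>"
  from assms(2)[OF flags_insert[OF assms(1) this]] show "F (insert U \<tau>) \<in> tuples k (\<Inter>\<tau>)"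
    by (rule tuples_mono[rotated]) auto
qed

section \<open>Dimensions occurring in a flag\<close>

lemma proper_subspace_dim_less:
  assumes "U \<in> proper_subspaces scale"
  shows "dim U < card Basis"
proof -
  have "span U = U" "U \<noteq> UNIV" using assms by (auto simp: proper_subspaces_def span_eq_iff)
  then have "dim U \<noteq> dimension" using dim_eq_full[of U] by (simp only: not_False_eq_True)
  then show ?thesis using dim_subset_UNIV[of U] by (simp add: dimension_def)
qed

lemma flag_dim_inj:
  assumes "\<sigma> \<in> flag_complex scale"
  shows "inj_on dim \<sigma>"
proof (rule inj_onI)
  fix U W assume UW: "U \<in> \<sigma>" "W \<in> \<sigma>" "dim U = dim W"
  have s: "subspace U" "subspace W" using flag_complexD(2)[OF assms] UW by auto
  have "U \<subseteq> W \<or> W \<subseteq> U" using flag_complexD(4)[OF assms] UW by (auto simp: chain_subset_def)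
  then show "U = W"
    using subspace_dim_equal[OF s] subspace_dim_equal[OF s(2,1)] UW(3) by auto
qed

lemma flag_dim_subset:
  assumes "\<sigma> \<in> flag_complex scale" "k \<le> dim (\<Inter>\<sigma>)"
  shows "dim ` \<sigma> \<subseteq> {k..<card Basis}"
proof
  fix d assume "d \<in> dim ` \<sigma>"
  then obtain U where U: "U \<in> \<sigma>" "d = dim U" by auto
  have "dim (\<Inter>\<sigma>) \<le> dim U" using U by (intro dim_subset) auto
  then show "d \<in> {k..<card Basis}"
    using U assms(2) proper_subspace_dim_less[OF flag_complexD(3)[OF assms(1) U(1)]] by simp
qed

lemma flag_dim_Inter_less:
  assumes "\<sigma> \<in> flag_complex scale" "card Basis < card \<sigma> + k"
  shows "dim (\<Inter>\<sigma>) < k"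
proof (rule ccontr)
  assume "\<not> dim (\<Inter>\<sigma>) < k"
  then have "card (dim ` \<sigma>) \<le> card {k..<card Basis}"
    using flag_dim_subset[OF assms(1), of k] by (intro card_mono) auto
  \<comment> \<open>\<open>dim_subset_UNIV\<close> supplies \<open>k \<le> card Basis\<close>, so
    that the size of the interval is not a truncated difference.\<close>
  then show False
    using card_image[OF flag_dim_inj[OF assms(1)]] assms(2) dim_subset_UNIV[of "\<Inter>\<sigma>"]
      \<open>\<not> dim (\<Inter>\<sigma>) < k\<close> by (simp add: dimension_def)
qed

lemma flag_full:
  assumes "\<sigma> \<in> flag_complex scale" "card Basis = k + card \<sigma>" "k \<le> dim (\<Inter>\<sigma>)"
  shows "full_flag k (card \<sigma>) \<sigma>"
proof -
  have "dim ` \<sigma> = {k..<k + card \<sigma>}"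
    using flag_dim_subset[OF assms(1,3)] card_image[OF flag_dim_inj[OF assms(1)]] assms(2)
    by (intro card_subset_eq) auto
  then show ?thesis
    using flag_complexD[OF assms(1)] by (auto simp: full_flag_def)
qed

lemma full_flag_Inter:
  assumes "full_flag k m \<sigma>" "U \<in> \<sigma>" "dim U = k"
  shows "\<Inter>\<sigma> = U"
proof -
  have "U \<subseteq> W" if "W \<in> \<sigma>" for W
  proof (rule full_flag_dim_less_imp_subset[OF assms(1,2) that])
    have "dim W \<in> {k..<k + m}" using assms(1) that by (auto simp: full_flag_def)
    then show "dim U \<le> dim W" using assms(3) by simp
  qed
  then show ?thesis using assms(2) by blast
qed

text \<open>The lower bound. The support is shown to be a set of full flags with the exchange
  property, so that \<open>exchangeable_card_ge\<close> counts it.\<close>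

lemma rep_cycle_supp_card_ge:
  assumes fin: "finite (UNIV :: 'b set)" and n: "card Basis = k + m" and m: "1 \<le> m" and p: "p = int m - 1"
    and F: "\<And>\<sigma>. \<sigma> \<in> flags p \<Longrightarrow> F \<sigma> \<in> tuples k (\<Inter>\<sigma>)"
    and cyc: "\<And>\<tau>. \<tau> \<in> flags (p - 1) \<Longrightarrow> rep_boundary F \<tau> \<in> ext_rel k (\<Inter>\<tau>)"
    and ne: "{\<sigma> \<in> flags p. F \<sigma> \<notin> ext_rel k (\<Inter>\<sigma>)} \<noteq> {}"
  shows "fact (m + 2) div 2 \<le> card {\<sigma> \<in> flags p. F \<sigma> \<notin> ext_rel k (\<Inter>\<sigma>)}"
proof -
  define S where "S = {\<sigma> \<in> flags p. F \<sigma> \<notin> ext_rel k (\<Inter>\<sigma>)}"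
  have SD: "\<sigma> \<in> flags p" "\<sigma> \<in> flag_complex scale" "card \<sigma> = m" "F \<sigma> \<notin> ext_rel k (\<Inter>\<sigma>)" if "\<sigma> \<in> S" for \<sigma>
    using that p by (auto simp: S_def simplices_def)
  have full: "full_flag k m \<sigma>" if "\<sigma> \<in> S" for \<sigma>
  proof -
    have "k \<le> dim (\<Inter>\<sigma>)"
    proof (rule ccontr)
      assume "\<not> k \<le> dim (\<Inter>\<sigma>)"
      then have "ext_rel k (\<Inter>\<sigma>) = tuples k (\<Inter>\<sigma>)"
        using flag_complexD(5)[OF SD(2)[OF that]] by (intro ext_rel_eq_tuples) auto
      then show False using F[OF SD(1)[OF that]] SD(4)[OF that] by blast
    qed
    then show ?thesis using flag_full[OF SD(2)[OF that]] SD(3)[OF that] n by simp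
  qed
  define J where "J \<tau> = {U \<in> coface_verts \<tau>. insert U \<tau> \<in> S}" for \<tau>
  have finsets: "finite A" for A :: "'b set set"
    using fin by (simp add: Finite_Set.finite_set finite_subset[OF subset_UNIV])
  \<comment> \<open>Coefficients outside the support are relations of their own space, hence of the
    larger \<open>\<Inter>\<tau>\<close>, and drop out of the cycle condition.\<close>
  have sumJ: "(\<Sum>U\<in>J \<tau>. signed (card {t \<in> \<tau>. t \<subset> U}) (F (insert U \<tau>))) \<in> ext_rel k (\<Inter>\<tau>)"
    if \<tau>: "\<tau> \<in> flags (p - 1)" for \<tau>
  proof -
    have s: "subspace (\<Inter>\<tau>)" using \<tau> by (intro flag_complexD(5)) (simp add: simplices_def)
    let ?g = "\<lambda>U. signed (card {t \<in> \<tau>. t \<subset> U}) (F (insert U \<tau>))"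
    have "rep_boundary F \<tau> = sum ?g (coface_verts \<tau> - J \<tau>) + sum ?g (J \<tau>)"
      unfolding rep_boundary_def using finsets
      by (intro sum.subset_diff) (auto simp: J_def)
    then have "sum ?g (J \<tau>) = rep_boundary F \<tau> - sum ?g (coface_verts \<tau> - J \<tau>)" by simp
    also have "\<dots> \<in> ext_rel k (\<Inter>\<tau>)"
    proof (intro ext_rel_diff s cyc \<tau> ext_rel_sum)
      fix U assume "U \<in> coface_verts \<tau> - J \<tau>"
      then have U: "U \<in> coface_verts \<tau>" "insert U \<tau> \<notin> S" by (auto simp: J_def)
      have X: "insert U \<tau> \<in> flags p" by (rule flags_insert[OF \<tau> U(1)])
      then have "F (insert U \<tau>) \<in> ext_rel k (\<Inter>(insert U \<tau>))" using U(2) by (auto simp: S_def)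
      then have "F (insert U \<tau>) \<in> ext_rel k (\<Inter>\<tau>)"
        using X by (intro ext_rel_mono[OF flag_complexD(5)[of "insert U \<tau>"] s]) (auto simp: simplices_def)
      then show "?g U \<in> ext_rel k (\<Inter>\<tau>)" by (simp add: ext_rel_signed_iff[OF s])
    qed
    finally show ?thesis .
  qed
  \<comment> \<open>Otherwise \<open>F \<sigma>\<close> alone would be a relation of
    \<open>\<Inter>(\<sigma> - {U})\<close>, and by injectivity a relation of
    \<open>\<Inter>\<sigma>\<close>.\<close>
  have one: "\<exists>U'. U' \<noteq> U \<and> U' \<in> J (\<sigma> - {U})" if \<sigma>: "\<sigma> \<in> S" and U: "U \<in> \<sigma>" for \<sigma> U
  proof (rule ccontr)
    let ?\<tau> = "\<sigma> - {U}"
    assume "\<not> ?thesis"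
    moreover have ins: "insert U ?\<tau> = \<sigma>" using U by blast
    moreover have "U \<in> coface_verts ?\<tau>" by (rule flags_remove(2)[OF SD(1)[OF \<sigma>] U])
    ultimately have J: "J ?\<tau> = {U}" using \<sigma> by (auto simp: J_def)
    have \<tau>: "?\<tau> \<in> flags (p - 1)" by (rule flags_remove(1)[OF SD(1)[OF \<sigma>] U])
    have s: "subspace (\<Inter>?\<tau>)" using \<tau> by (intro flag_complexD(5)) (simp add: simplices_def)
    have "F \<sigma> \<in> ext_rel k (\<Inter>?\<tau>)"
      using sumJ[OF \<tau>] unfolding J by (simp add: ext_rel_signed_iff[OF s] insert_absorb[OF U])
    then have "F \<sigma> \<in> ext_rel k (\<Inter>\<sigma>)"
      by (intro ext_rel_restrict[OF flag_complexD(5)[OF SD(2)[OF \<sigma>]] _ s F[OF SD(1)[OF \<sigma>]]]) auto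
    then show False using SD(4)[OF \<sigma>] by blast
  qed
  \<comment> \<open>Otherwise two terms with distinct bottoms of dimension \<open>k\<close> would
    cancel; projecting along a vector of the second bottom shows that the first term already
    vanishes.\<close>
  have two: "\<exists>U''. U'' \<noteq> U \<and> U'' \<noteq> U' \<and> U'' \<in> J (\<sigma> - {U})"
    if \<sigma>: "\<sigma> \<in> S" and U: "U \<in> \<sigma>" "dim U = k" and U': "U' \<noteq> U" "U' \<in> J (\<sigma> - {U})" for \<sigma> U U'
  proof (rule ccontr)
    let ?\<tau> = "\<sigma> - {U}" and ?\<sigma>' = "insert U' (\<sigma> - {U})"
    assume "\<not> ?thesis"
    moreover have ins: "insert U ?\<tau> = \<sigma>" using U by blast
    moreover have "U \<in> coface_verts ?\<tau>" by (rule flags_remove(2)[OF SD(1)[OF \<sigma>] U(1)])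
    ultimately have J: "J ?\<tau> = {U, U'}" using \<sigma> U' by (auto simp: J_def)
    have \<sigma>': "?\<sigma>' \<in> S" using U'(2) by (simp add: J_def)
    have \<tau>: "?\<tau> \<in> flags (p - 1)" by (rule flags_remove(1)[OF SD(1)[OF \<sigma>] U(1)])
    have s: "subspace (\<Inter>?\<tau>)" using \<tau> by (intro flag_complexD(5)) (simp add: simplices_def)
    have dim': "dim U' = k"
      using full_flag_exchange_dim(1)[OF full[OF \<sigma>] U(1) full[OF \<sigma>']] U(2) by simp
    have I: "\<Inter>\<sigma> = U" "\<Inter>?\<sigma>' = U'"
      by (rule full_flag_Inter[OF full[OF \<sigma>] U], rule full_flag_Inter[OF full[OF \<sigma>'] insertI1 dim'])
    have sub: "subspace U" "subspace U'"
      using flag_complexD(2)[OF SD(2)[OF \<sigma>] U(1)] flag_complexD(2)[OF SD(2)[OF \<sigma>'] insertI1] .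
    have "U \<subseteq> \<Inter>?\<tau>" "U' \<subseteq> \<Inter>?\<tau>" using I by auto
    moreover have "\<not> U' \<subseteq> U" using subspace_dim_equal[OF sub(2,1)] U(2) dim' U'(1) by auto
    moreover have "signed (card {t \<in> ?\<tau>. t \<subset> U}) (F \<sigma>) + signed (card {t \<in> ?\<tau>. t \<subset> U'}) (F ?\<sigma>') \<in> ext_rel k (\<Inter>?\<tau>)"
      using sumJ[OF \<tau>] U'(1) unfolding J by (simp add: insert_absorb[OF U(1)])
    moreover have "signed (card {t \<in> ?\<tau>. t \<subset> U}) (F \<sigma>) \<in> tuples k U"
      using F[OF SD(1)[OF \<sigma>]] unfolding I(1) by (rule tuples_signed)
    moreover have "signed (card {t \<in> ?\<tau>. t \<subset> U'}) (F ?\<sigma>') \<in> tuples k U'"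
      using F[OF SD(1)[OF \<sigma>']] unfolding I(2) by (rule tuples_signed)
    ultimately have "signed (card {t \<in> ?\<tau>. t \<subset> U}) (F \<sigma>) \<in> ext_rel k U"
      using sub s dim' by (intro ext_rel_add_restrict[of U "\<Inter>?\<tau>" U']) simp_all
    then have "F \<sigma> \<in> ext_rel k U" by (simp only: ext_rel_signed_iff[OF sub(1)])
    then show False using SD(4)[OF \<sigma>] I(1) by simp
  qed
  have "exchangeable k S"
    unfolding exchangeable_def
  proof (intro conjI ballI impI)
    fix \<sigma> U assume "\<sigma> \<in> S" "U \<in> \<sigma>"
    from one[OF this] show "\<exists>U'. U' \<noteq> U \<and> insert U' (\<sigma> - {U}) \<in> S" by (auto simp: J_def)
  next
    fix \<sigma> U assume \<sigma>: "\<sigma> \<in> S" "U \<in> \<sigma>" "dim U = k"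
    obtain U' where U': "U' \<noteq> U" "U' \<in> J (\<sigma> - {U})" using one[OF \<sigma>(1,2)] by blast
    obtain U'' where U'': "U'' \<noteq> U" "U'' \<noteq> U'" "U'' \<in> J (\<sigma> - {U})" using two[OF \<sigma> U'] by blast
    show "\<exists>U' U''. U' \<noteq> U \<and> U'' \<noteq> U \<and> U' \<noteq> U'' \<and> insert U' (\<sigma> - {U}) \<in> S \<and> insert U'' (\<sigma> - {U}) \<in> S"
      using U' U'' by (intro exI[of _ U'] exI[of _ U'']) (simp add: J_def)
  qed
  moreover have "finite S" using fin by (simp add: Finite_Set.finite_set finite_subset[OF subset_UNIV])
  ultimately have "fact (m + 2) div 2 \<le> card S"
    using exchangeable_card_ge[of S k m] ne full m by (simp add: S_def del: fact_Suc)
  then show ?thesis by (simp only: S_def)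
qed

text \<open>The cycle of the full index set: \<open>m + 2\<close> indices, whose coordinate space is
  the whole space, so that intersecting with it has no effect.\<close>

lemma exists_rep_cycle:
  assumes fin: "finite (UNIV :: 'b set)" and n: "card Basis = k + m" and k: "1 \<le> k" and p: "p = int m - 1"
  shows "\<exists>F. (\<forall>\<sigma>. F \<sigma> \<in> tuples k (\<Inter>\<sigma>))
    \<and> (\<forall>\<tau>\<in>flags (p - 1). rep_boundary F \<tau> \<in> ext_rel k (\<Inter>\<tau>))
    \<and> {\<sigma> \<in> flags p. F \<sigma> \<notin> ext_rel k (\<Inter>\<sigma>)} \<noteq> {}
    \<and> card {\<sigma> \<in> flags p. F \<sigma> \<notin> ext_rel k (\<Inter>\<sigma>)} \<le> fact (m + 2) div 2"
proof -
  obtain \<phi> \<psi> u \<kappa> where "general_position scale Basis (m + 2) k \<phi> \<psi> u \<kappa>"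
    using exists_general_position[OF n k] by blast
  then interpret G: general_position scale Basis "m + 2" k \<phi> \<psi> u \<kappa> .
  define F where "F = G.flag_cycle m {..<m + 2}"
  have B: "{..<m + 2} \<subseteq> {..<m + 2}" "card {..<m + 2} = m + 2" by auto
  have flag: "\<sigma> \<in> flags p" if "F \<sigma> \<noteq> 0" for \<sigma>
  proof -
    note nz = B that[unfolded F_def]
    have "U \<in> proper_subspaces scale" if U: "U \<in> \<sigma>" for U
    proof -
      obtain C where C: "C \<subseteq> {..<m + 2}" "2 \<le> card C" "U = G.coord_space C"
        using G.flag_cycle_nonzero_coord[OF nz] U by auto
      have "U \<noteq> UNIV" using G.flag_cycle_nonzero_psubset[OF nz U] by auto
      then show ?thesis
        using C G.coord_space_nonzero[OF C(1,2)] G.subspace_coord_space by (simp add: proper_subspaces_def)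
    qed
    then show ?thesis
      using G.flag_cycle_nonzero_card[OF nz] G.flag_cycle_nonzero_chain[OF nz] p
      by (auto simp: simplices_def flag_complex_def chain_subset_def)
  qed
  have tup: "F \<sigma> \<in> tuples k (\<Inter>\<sigma>)" for \<sigma>
    using G.flag_cycle_tuples[OF B, of \<sigma>] by (simp only: F_def G.coord_space_full inf_top_right)
  have bd: "rep_boundary F \<tau> \<in> ext_rel k (\<Inter>\<tau>)" if \<tau>: "\<tau> \<in> flags (p - 1)" for \<tau>
  proof -
    have X: "\<tau> \<in> flag_complex scale" using \<tau> by (simp add: simplices_def)
    \<comment> \<open>The sum may run over all sets outside \<open>\<tau>\<close>, because
      \<open>F\<close> is 0 off the flags; this is the shape of
      \<open>flag_cycle_boundary\<close>.\<close>
    have "rep_boundary F \<tau> = (\<Sum>U\<in>UNIV - \<tau>. signed (card {t \<in> \<tau>. t \<subset> U}) (F (insert U \<tau>)))"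
      unfolding rep_boundary_def
    proof (rule sum.mono_neutral_left)
      show "finite (UNIV - \<tau>)" using fin by (simp add: Finite_Set.finite_set finite_subset[OF subset_UNIV])
      show "coface_verts \<tau> \<subseteq> UNIV - \<tau>" by (auto simp: coface_verts_def)
      show "\<forall>U\<in>UNIV - \<tau> - coface_verts \<tau>. signed (card {t \<in> \<tau>. t \<subset> U}) (F (insert U \<tau>)) = 0"
      proof
        fix U assume "U \<in> UNIV - \<tau> - coface_verts \<tau>"
        then have "insert U \<tau> \<notin> flags p" by (auto simp: coface_verts_def simplices_def)
        then have "F (insert U \<tau>) = 0" using flag by blast
        then show "signed (card {t \<in> \<tau>. t \<subset> U}) (F (insert U \<tau>)) = 0" by simp
      qed
    qed
    also have "\<dots> \<in> ext_rel k (\<Inter>\<tau> \<inter> G.coord_space {..<m + 2})"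
      unfolding F_def
      using fin flag_complexD[OF X]
      by (intro G.flag_cycle_boundary B) (auto simp: Finite_Set.finite_set)
    finally show ?thesis by (simp only: G.coord_space_full inf_top_right)
  qed
  have ne: "{\<sigma> \<in> flags p. F \<sigma> \<notin> ext_rel k (\<Inter>\<sigma>)} \<noteq> {}"
  proof -
    obtain \<sigma> i b c where bc: "b < m + 2" "c < m + 2" "b \<noteq> c"
      and F\<sigma>: "F \<sigma> = signed i (Poly_Mapping.single (\<kappa> @ [u b - u c]) 1)"
      using G.flag_cycle_witness[OF B] unfolding F_def by blast
    have not: "F \<sigma> \<notin> ext_rel k U" if "subspace U" for U
      unfolding F\<sigma> by (rule G.flag_cycle_witness_not_ext_rel[OF bc that])
    have "F \<sigma> \<noteq> 0" using not[OF subspace_UNIV] ext_rel_zero[OF subspace_UNIV] by auto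
    then have \<sigma>: "\<sigma> \<in> flags p" by (rule flag)
    then have "subspace (\<Inter>\<sigma>)" by (intro flag_complexD(5)) (simp add: simplices_def)
    then show ?thesis using \<sigma> not by blast
  qed
  have le: "card {\<sigma> \<in> flags p. F \<sigma> \<notin> ext_rel k (\<Inter>\<sigma>)} \<le> fact (m + 2) div 2"
  proof -
    have "{\<sigma> \<in> flags p. F \<sigma> \<notin> ext_rel k (\<Inter>\<sigma>)} \<subseteq> {\<sigma>. F \<sigma> \<noteq> 0}"
    proof
      fix \<sigma> assume \<sigma>: "\<sigma> \<in> {\<sigma> \<in> flags p. F \<sigma> \<notin> ext_rel k (\<Inter>\<sigma>)}"
      then have "subspace (\<Inter>\<sigma>)" by (intro flag_complexD(5)) (simp add: simplices_def)
      then show "\<sigma> \<in> {\<sigma>. F \<sigma> \<noteq> 0}" using \<sigma> ext_rel_zero[of "\<Inter>\<sigma>" k] by auto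
    qed
    moreover have "finite {\<sigma>. F \<sigma> \<noteq> 0}" "card {\<sigma>. F \<sigma> \<noteq> 0} \<le> fact (m + 2) div 2"
      using G.flag_cycle_supp[OF finite_lessThan B(2)] by (auto simp only: F_def)
    ultimately show ?thesis using card_mono order_trans by blast
  qed
  show ?thesis by (intro exI[of _ F] conjI allI ballI tup bd ne le)
qed

section \<open>From representatives back to homology classes\<close>

abbreviation flag_chains :: "nat \<Rightarrow> int \<Rightarrow> ('b set set \<Rightarrow> ('b list \<Rightarrow>\<^sub>0 'a) set) monoid" where
  "flag_chains k p \<equiv> chain_group (flag_complex scale) (ext_stalk scale k) p"

abbreviation flag_boundary where
  "flag_boundary r k p \<equiv> boundary (flag_complex scale) r (ext_stalk scale k) (ext_connecting scale k) p"

lemma one_flag_chains: "\<one>\<^bsub>flag_chains k p\<^esub> = (\<lambda>\<sigma>\<in>flags p. \<one>\<^bsub>ext_stalk scale k \<sigma>\<^esub>)"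
  by (simp add: chain_group_def)

lemma one_flag_chains_mult:
  assumes "c \<in> carrier (flag_chains k p)"
  shows "\<one>\<^bsub>flag_chains k p\<^esub> \<otimes>\<^bsub>flag_chains k p\<^esub> c = c"
proof -
  have "group (ext_stalk scale k \<sigma>)" if "\<sigma> \<in> flags p" for \<sigma>
  proof -
    have "\<sigma> \<in> flag_complex scale" using that by (simp add: simplices_def)
    then show ?thesis
      unfolding ext_stalk_def
      using comm_group_exterior_power[OF vector_space_axioms flag_complexD(5)] by (auto simp: comm_group_def)
  qed
  then have "group (flag_chains k p)" by (simp add: chain_group_def)
  then show ?thesis using assms by (intro monoid.l_one) (simp_all add: group_def)
qed

lemma flag_boundary_eq_one_iff:
  assumes "finite (UNIV :: 'b set)" "dim_order r"
    and F: "\<And>\<sigma>. \<sigma> \<in> flags p \<Longrightarrow> F \<sigma> \<in> tuples k (\<Inter>\<sigma>)"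
    and c: "\<And>\<sigma>. \<sigma> \<in> flags p \<Longrightarrow> c \<sigma> = ext_class k (\<Inter>\<sigma>) (F \<sigma>)"
  shows "flag_boundary r k p c = \<one>\<^bsub>flag_chains k (p - 1)\<^esub> \<longleftrightarrow>
    (\<forall>\<tau>\<in>flags (p - 1). rep_boundary F \<tau> \<in> ext_rel k (\<Inter>\<tau>))"
proof -
  have "flag_boundary r k p c \<tau> = \<one>\<^bsub>ext_stalk scale k \<tau>\<^esub> \<longleftrightarrow> rep_boundary F \<tau> \<in> ext_rel k (\<Inter>\<tau>)"
    if \<tau>: "\<tau> \<in> flags (p - 1)" for \<tau>
  proof -
    have "subspace (\<Inter>\<tau>)" using \<tau> by (intro flag_complexD(5)) (simp add: simplices_def)
    moreover have "flag_boundary r k p c \<tau> = ext_class k (\<Inter>\<tau>) (rep_boundary F \<tau>)"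
      by (rule boundary_ext_class[OF assms(1,2) \<tau>]) (fact F c)+
    ultimately show ?thesis
      unfolding ext_stalk_def[of scale k \<tau>] by (simp only:) (rule ext_class_eq_one_iff[OF _ rep_boundary_tuples[OF \<tau> F]])
  qed
  moreover have "flag_boundary r k p c \<in> extensional (flags (p - 1))"
    unfolding boundary_def by (rule restrict_extensional)
  ultimately show ?thesis
    unfolding one_flag_chains
    by (auto simp: fun_eq_iff extensional_def restrict_def)
qed

lemma flag_chain_repE:
  assumes "c \<in> carrier (flag_chains k p)"
  obtains F where "\<And>\<sigma>. \<sigma> \<in> flags p \<Longrightarrow> F \<sigma> \<in> tuples k (\<Inter>\<sigma>)"
    "\<And>\<sigma>. \<sigma> \<in> flags p \<Longrightarrow> c \<sigma> = ext_class k (\<Inter>\<sigma>) (F \<sigma>)"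
proof -
  have "\<exists>f. f \<in> tuples k (\<Inter>\<sigma>) \<and> c \<sigma> = ext_class k (\<Inter>\<sigma>) f" if "\<sigma> \<in> flags p" for \<sigma>
  proof -
    have "c \<sigma> \<in> carrier (exterior_power scale k (\<Inter>\<sigma>))"
      using assms that by (auto simp: chain_group_def ext_stalk_def)
    then show ?thesis by (rule exterior_power_carrierE) blast
  qed
  then show ?thesis using that by metis
qed

lemma flag_chain_supp:
  assumes F: "\<And>\<sigma>. \<sigma> \<in> flags p \<Longrightarrow> F \<sigma> \<in> tuples k (\<Inter>\<sigma>)"
    and c: "\<And>\<sigma>. \<sigma> \<in> flags p \<Longrightarrow> c \<sigma> = ext_class k (\<Inter>\<sigma>) (F \<sigma>)"
  shows "chain_supp (flag_complex scale) (ext_stalk scale k) p c = {\<sigma> \<in> flags p. F \<sigma> \<notin> ext_rel k (\<Inter>\<sigma>)}"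
proof -
  have "c \<sigma> = \<one>\<^bsub>ext_stalk scale k \<sigma>\<^esub> \<longleftrightarrow> F \<sigma> \<in> ext_rel k (\<Inter>\<sigma>)" if "\<sigma> \<in> flags p" for \<sigma>
  proof -
    have "subspace (\<Inter>\<sigma>)" using that by (intro flag_complexD(5)) (simp add: simplices_def)
    then show ?thesis
      unfolding c[OF that] ext_stalk_def by (rule ext_class_eq_one_iff[OF _ F[OF that]])
  qed
  then show ?thesis by (auto simp: chain_supp_def)
qed

lemma flag_chain_supp_empty_iff:
  assumes "c \<in> carrier (flag_chains k p)"
  shows "chain_supp (flag_complex scale) (ext_stalk scale k) p c = {} \<longleftrightarrow> c = \<one>\<^bsub>flag_chains k p\<^esub>"
proof -
  have "c \<in> extensional (flags p)" using assms by (auto simp: chain_group_def PiE_def)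
  then show ?thesis
    unfolding one_flag_chains chain_supp_def
    by (auto intro!: extensionalityI[of c "flags p"])
qed

text \<open>A flag with \<open>m + 1\<close> members has a smallest member of dimension below
  \<open>k\<close>, so every chain one degree up has the same classes as the zero chain.\<close>

lemma flag_boundary_image_trivial:
  assumes "finite (UNIV :: 'b set)" "dim_order r" and n: "card Basis = k + m" and p: "p = int m - 1"
  shows "flag_boundary r k (p + 1) ` carrier (flag_chains k (p + 1)) = {\<one>\<^bsub>flag_chains k p\<^esub>}"
proof -
  have cls: "ext_class k (\<Inter>\<sigma>) f = ext_class k (\<Inter>\<sigma>) 0" if \<sigma>: "\<sigma> \<in> flags (p + 1)" and f: "f \<in> tuples k (\<Inter>\<sigma>)" for \<sigma> f
  proof -
    have X: "\<sigma> \<in> flag_complex scale" "card \<sigma> = m + 1" using \<sigma> p by (auto simp: simplices_def)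
    have s: "subspace (\<Inter>\<sigma>)" by (rule flag_complexD(5)[OF X(1)])
    have "f \<in> ext_rel k (\<Inter>\<sigma>)"
      using ext_rel_eq_tuples[OF s flag_dim_Inter_less[OF X(1)]] f n X(2) by auto
    then show ?thesis
      using ext_class_eq_one_iff[OF s f] ext_class_eq_one_iff[OF s tuples_zero] ext_rel_zero[OF s] by simp
  qed
  have triv: "flag_boundary r k (p + 1) c = \<one>\<^bsub>flag_chains k p\<^esub>" if c: "c \<in> carrier (flag_chains k (p + 1))" for c
  proof -
    obtain F where F: "\<And>\<sigma>. \<sigma> \<in> flags (p + 1) \<Longrightarrow> F \<sigma> \<in> tuples k (\<Inter>\<sigma>)"
      "\<And>\<sigma>. \<sigma> \<in> flags (p + 1) \<Longrightarrow> c \<sigma> = ext_class k (\<Inter>\<sigma>) (F \<sigma>)"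
      using flag_chain_repE[OF c] by metis
    have "c \<sigma> = ext_class k (\<Inter>\<sigma>) 0" if "\<sigma> \<in> flags (p + 1)" for \<sigma>
      using F(2)[OF that] cls[OF that F(1)[OF that]] by simp
    then have "flag_boundary r k (p + 1) c = \<one>\<^bsub>flag_chains k (p + 1 - 1)\<^esub> \<longleftrightarrow>
        (\<forall>\<tau>\<in>flags (p + 1 - 1). rep_boundary (\<lambda>_. 0) \<tau> \<in> ext_rel k (\<Inter>\<tau>))"
      by (intro flag_boundary_eq_one_iff assms(1,2) tuples_zero)
    moreover have "rep_boundary (\<lambda>_. 0) \<tau> \<in> ext_rel k (\<Inter>\<tau>)" if "\<tau> \<in> flags (p + 1 - 1)" for \<tau>
      using that ext_rel_zero[OF flag_complexD(5)[of \<tau>]] by (simp add: rep_boundary_def simplices_def)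
    ultimately show ?thesis by simp
  qed
  have "(\<lambda>\<sigma>\<in>flags (p + 1). ext_class k (\<Inter>\<sigma>) 0) \<in> carrier (flag_chains k (p + 1))"
    by (auto simp: chain_group_def ext_stalk_def intro!: ext_class_carrier tuples_zero simp del: tuple_space_simps(1))
  from image_constant[OF this] show ?thesis
    using image_cong[OF refl triv, of "carrier (flag_chains k (p + 1))"] by (simp only:)
qed

text \<open>Factoring out the trivial group turns each cycle into a singleton coset; choosing
  \<open>c\<close> in a class \<open>w\<close> therefore involves no choice.\<close>

lemma D_group_eq:
  assumes "finite (UNIV :: 'b set)" "dim_order r" and n: "card Basis = k + m" and p: "p = int m - 1"
  shows "carrier (D_group scale r k) = (\<lambda>c. {c}) ` kernel (flag_chains k p) (flag_chains k (p - 1)) (flag_boundary r k p)"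
    and "\<one>\<^bsub>D_group scale r k\<^esub> = {\<one>\<^bsub>flag_chains k p\<^esub>}"
proof -
  let ?Z = "kernel (flag_chains k p) (flag_chains k (p - 1)) (flag_boundary r k p)"
  have "int (dim (UNIV :: 'b set)) - int k - 1 = p" using n p by simp
  then have D: "D_group scale r k = (flag_chains k p)\<lparr>carrier := ?Z\<rparr> Mod {\<one>\<^bsub>flag_chains k p\<^esub>}"
    unfolding D_group_def reduced_homology_def flag_boundary_image_trivial[OF assms, symmetric] by (simp only:)
  show "\<one>\<^bsub>D_group scale r k\<^esub> = {\<one>\<^bsub>flag_chains k p\<^esub>}"
    unfolding D by simp
  have "{\<one>\<^bsub>flag_chains k p\<^esub>} #>\<^bsub>(flag_chains k p)\<lparr>carrier := ?Z\<rparr>\<^esub> c = {c}" if "c \<in> ?Z" for c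
    using one_flag_chains_mult[of c k p] that by (simp add: r_coset_def kernel_def)
  then show "carrier (D_group scale r k) = (\<lambda>c. {c}) ` ?Z"
    unfolding D carrier_FactGroup by (auto simp: image_iff)
qed

lemma Min_chain_supp:
  assumes fin: "finite (UNIV :: 'b set)" and r: "dim_order r" and n: "card Basis = k + m"
    and k: "1 \<le> k" and m: "1 \<le> m" and p: "p = int m - 1"
  defines "S \<equiv> {card (chain_supp (flag_complex scale) (ext_stalk scale k) p c) |w c.
                  w \<in> carrier (D_group scale r k) \<and> w \<noteq> \<one>\<^bsub>D_group scale r k\<^esub> \<and> c \<in> w}"
  shows "S \<noteq> {} \<and> Min S = fact (m + 2) div 2"
proof -
  let ?supp = "chain_supp (flag_complex scale) (ext_stalk scale k) p"
  let ?Z = "kernel (flag_chains k p) (flag_chains k (p - 1)) (flag_boundary r k p)"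
  have S: "S = (\<lambda>c. card (?supp c)) ` {c \<in> ?Z. c \<noteq> \<one>\<^bsub>flag_chains k p\<^esub>}"
  proof (intro subset_antisym subsetI)
    fix x assume "x \<in> S"
    then obtain w c where "x = card (?supp c)" "w \<in> (\<lambda>c. {c}) ` ?Z" "w \<noteq> {\<one>\<^bsub>flag_chains k p\<^esub>}" "c \<in> w"
      unfolding S_def D_group_eq[OF fin r n p] by blast
    then show "x \<in> (\<lambda>c. card (?supp c)) ` {c \<in> ?Z. c \<noteq> \<one>\<^bsub>flag_chains k p\<^esub>}" by (elim imageE) simp
  next
    fix x assume "x \<in> (\<lambda>c. card (?supp c)) ` {c \<in> ?Z. c \<noteq> \<one>\<^bsub>flag_chains k p\<^esub>}"
    then obtain c where c: "x = card (?supp c)" "c \<in> ?Z" "c \<noteq> \<one>\<^bsub>flag_chains k p\<^esub>" by blast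
    have "{c} \<in> (\<lambda>c. {c}) ` ?Z" "{c} \<noteq> {\<one>\<^bsub>flag_chains k p\<^esub>}" "c \<in> {c}"
      using c(2,3) by (blast, simp, simp)
    then show "x \<in> S"
      unfolding S_def D_group_eq[OF fin r n p] using c(1) by blast
  qed
  have lower: "fact (m + 2) div 2 \<le> card (?supp c)" if c: "c \<in> ?Z" "c \<noteq> \<one>\<^bsub>flag_chains k p\<^esub>" for c
  proof -
    have carr: "c \<in> carrier (flag_chains k p)" and bd: "flag_boundary r k p c = \<one>\<^bsub>flag_chains k (p - 1)\<^esub>"
      using c(1) by (auto simp: kernel_def)
    obtain F where F: "\<And>\<sigma>. \<sigma> \<in> flags p \<Longrightarrow> F \<sigma> \<in> tuples k (\<Inter>\<sigma>)"
      "\<And>\<sigma>. \<sigma> \<in> flags p \<Longrightarrow> c \<sigma> = ext_class k (\<Inter>\<sigma>) (F \<sigma>)"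
      using flag_chain_repE[OF carr] by metis
    have supp: "?supp c = {\<sigma> \<in> flags p. F \<sigma> \<notin> ext_rel k (\<Inter>\<sigma>)}" by (rule flag_chain_supp[OF F])
    have "?supp c \<noteq> {}" using flag_chain_supp_empty_iff[OF carr] c(2) by simp
    then show ?thesis
      unfolding supp using bd flag_boundary_eq_one_iff[OF fin r F]
      by (intro rep_cycle_supp_card_ge[OF fin n m p F(1)]) auto
  qed
  obtain F where FF: "\<forall>\<sigma>. F \<sigma> \<in> tuples k (\<Inter>\<sigma>)"
    "\<forall>\<tau>\<in>flags (p - 1). rep_boundary F \<tau> \<in> ext_rel k (\<Inter>\<tau>)"
    "{\<sigma> \<in> flags p. F \<sigma> \<notin> ext_rel k (\<Inter>\<sigma>)} \<noteq> {}"
    "card {\<sigma> \<in> flags p. F \<sigma> \<notin> ext_rel k (\<Inter>\<sigma>)} \<le> fact (m + 2) div 2"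
    using exists_rep_cycle[OF fin n k p] by (elim exE conjE)
  note F = spec[OF FF(1)] bspec[OF FF(2)] FF(3,4)
  define c where "c = (\<lambda>\<sigma>\<in>flags p. ext_class k (\<Inter>\<sigma>) (F \<sigma>))"
  have c: "c \<sigma> = ext_class k (\<Inter>\<sigma>) (F \<sigma>)" if "\<sigma> \<in> flags p" for \<sigma> using that by (simp add: c_def)
  have carr: "c \<in> carrier (flag_chains k p)"
    using F(1) by (auto simp: c_def chain_group_def ext_stalk_def intro!: ext_class_carrier simp del: tuple_space_simps(1))
  have supp: "?supp c = {\<sigma> \<in> flags p. F \<sigma> \<notin> ext_rel k (\<Inter>\<sigma>)}" by (rule flag_chain_supp[OF F(1) c])
  have Z: "c \<in> ?Z"
    using carr flag_boundary_eq_one_iff[of r p F k c, OF fin r F(1) c] F(2) by (simp add: kernel_def)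
  have ne: "c \<noteq> \<one>\<^bsub>flag_chains k p\<^esub>"
    using flag_chain_supp_empty_iff[OF carr] F(3) supp by simp
  have "card (?supp c) = fact (m + 2) div 2"
    using lower[OF Z ne] F(4) supp by (metis order_antisym)
  then have mem: "fact (m + 2) div 2 \<in> S" unfolding S using Z ne by (metis (mono_tags, lifting) imageI mem_Collect_eq)
  have "finite (Pow (flags p))" using fin by (simp add: Finite_Set.finite_set finite_subset[OF subset_UNIV])
  then have "finite (card ` Pow (flags p))" by simp
  moreover have "S \<subseteq> card ` Pow (flags p)" unfolding S by (auto simp: chain_supp_def)
  ultimately have "finite S" by (rule finite_subset[rotated])
  then have "Min S = fact (m + 2) div 2"
    using mem lower by (intro Min_eqI) (auto simp: S)
  then show ?thesis using mem by blast
qed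

end

section \<open>Passage to a finite ambient space\<close>

lemma (in vector_space) finite_span:
  assumes "finite (UNIV :: 'a set)" "finite S"
  shows "finite (span S)"
  using assms(2)
proof induction
  case (insert a S)
  have "span (insert a S) \<subseteq> (\<lambda>(c, x). x + scale c a) ` (UNIV \<times> span S)"
  proof
    fix x assume "x \<in> span (insert a S)"
    then obtain c where "x - scale c a \<in> span S" by (auto simp: span_insert)
    then show "x \<in> (\<lambda>(c, x). x + scale c a) ` (UNIV \<times> span S)"
      by (intro image_eqI[of _ _ "(c, x - scale c a)"]) auto
  qed
  then show ?case using insert.IH assms(1) by (auto dest: finite_subset)
qed simp

theorem theorem1p6:
  fixes scale :: "'a::{field, finite} \<Rightarrow> 'v::ab_group_add \<Rightarrow> 'v"
    and r :: "'v set rel"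
    and n k :: nat
  assumes "vector_space scale"
    and "vector_space.dim scale (UNIV :: 'v set) = n"
    and "1 \<le> k" and "k \<le> n - 1"
    and "linear_order_on (proper_subspaces scale) r"
    and "\<And>U W. U \<in> proper_subspaces scale \<Longrightarrow> W \<in> proper_subspaces scale \<Longrightarrow>
           vector_space.dim scale U < vector_space.dim scale W \<Longrightarrow> (U, W) \<in> r"
  shows "let S = {card (chain_supp (flag_complex scale) (ext_stalk scale k) (int n - int k - 1) c) |w c.
                  w \<in> carrier (D_group scale r k) \<and> w \<noteq> \<one>\<^bsub>D_group scale r k\<^esub> \<and> c \<in> w}
         in S \<noteq> {} \<and> Min S = fact (n - k + 2) div 2"
proof -
  interpret vector_space scale by fact
  obtain B where B: "independent B" "UNIV \<subseteq> span B" "card B = n"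
    using basis_exists[of UNIV] assms(2) by metis
  \<comment> \<open>Positivity of \<open>n\<close> excludes an infinite basis, whose
    \<open>card\<close> would be 0.\<close>
  have "n > 0" using assms(3,4) by simp
  then have finB: "finite B" using B(3) card_gt_0_iff by blast
  interpret exterior_space scale B
    by unfold_locales (use B finB in auto)
  have fin: "finite (UNIV :: 'v set)"
    using finite_span[OF finite finB] B(2) finite_subset by blast
  have "dim_order r" using assms(5,6) by (auto simp: dim_order_def)
  from Min_chain_supp[OF fin this, of k "n - k" "int n - int k - 1"] show ?thesis
    using assms(3,4) B(3) by (simp add: Let_def of_nat_diff del: fact_Suc)
qed

end
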